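(* Let $p$ be an odd prime, $q$ a power of $p$, $\ell$ an odd prime with $\ell\ne p$, $m,n$ positive integers, and $f=\mathrm{ord}_\ell(q)$. (i) If $q\equiv1\pmod 4$, the LCD negacyclic codes of length $2\ell^mp^n$ over $\mathbb F_q$ are exactly the codes generated by $\prod_{i=0}^{e}\hat M_{\rho_i}(\beta X)^{\varepsilon_i}\hat M_{-\rho_i}(-\beta X)^{\varepsilon_i}$ with $\varepsilon_i\in\{0,p^n\}$, and there are exactly $2^{e+1}$ of them. (ii) If $q\equiv3\pmod4$ and $f$ is odd, the LCD negacyclic codes of length $2\ell^mp^n$ over $\mathbb F_q$ are exactly the codes generated by $$(X^2+1)^{\varepsilon_0}\prod_{r=1}^{m}\prod_{k=0}^{\frac{\delta(r)}{2}-1}I_{r,k}(X)^{\varepsilon_k^r}J_{r,k}(X)^{\varepsilon_k^r},\qquad\varepsilon_0,\varepsilon_k^r\in\{0,p^n\},$$ where $I_{r,k}(X)=\hat M_{\ell^{m-r}g^k}(\theta X)\hat M_{\ell^{m-r}g^k}(-\theta X)$ and $J_{r,k}(X)=\hat M_{-\ell^{m-r}g^k}(\theta X)\hat M_{-\ell^{m-r}g^k}(-\theta X)$, and there are exactly $2^{1+\frac e2}$ of them. (iii) If $q\equiv3\pmod4$ and $f\equiv2\pmod4$, the LCD negacyclic codes of length $2\ell^mp^n$ over $\mathbb F_q$ are exactly the codes generated by $(X^2+1)^{\varepsilon_0}\prod_{k=1}^{e}S_k(X)^{\varepsilon_k}T_k(X)^{\epsilon_k}$ with $\varepsilon_0,\varepsilon_k,\epsilon_k\in\{0,p^n\}$,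 where $S_k(X)=\hat N_{\rho_k}(\theta X)\hat N_{\rho_kq}(-\theta X)$ and $T_k(X)=\hat N_{\rho_k}(-\theta X)\hat N_{\rho_kq}(\theta X)$; there are exactly $2^{1+2e}$ of them. (iv) If $q\equiv3\pmod4$ and $f\equiv0\pmod4$, the LCD negacyclic codes of length $2\ell^mp^n$ over $\mathbb F_q$ are exactly the codes generated by $(X^2+1)^{\varepsilon_0}\prod_{k=1}^{e}S_k(X)^{\varepsilon_k}T_k(X)^{\varepsilon_k}$ with $\varepsilon_0,\varepsilon_k\in\{0,p^n\}$ ($S_k,T_k$ as in (iii)); there are exactly $2^{1+e}$ of them.
   Context: A negacyclic code of length $N$ over $\mathbb F_q$ is an ideal of $\mathbb F_q[X]/\langle X^N+1\rangle$; the code generated by $g(X)$ is the ideal generated by its image. A linear code $C$ is LCD if $C\cap C^\perp=\{0\}$ ($C^\perp$ the Euclidean dual). For a nonzero polynomial $h$ with leading coefficient $c$, $\hat h=c^{-1}h$. For an integer $t$, $C_t=\{tq^i\bmod\ell^m:i\ge0\}$; $\rho_0=0,\rho_1,\dots,\rho_e$ are representatives of all distinct $q$-cyclotomic cosets modulo $\ell^m$. $\eta$ is a primitive $\ell^m$-th root of unity in an extension of $\mathbb F_q$, $M_t(X)=\prod_{s\in C_t}(X-\eta^s)$. When $f$ is even, $D_t=\{tq^{2i}\bmod\ell^m:i\ge0\}$, $C_{\rho_k}=D_{\rho_k}\cup D_{\rho_kq}$ (disjoint) for $1\le k\le e$, and $N_t(X)=\prod_{s\in D_t}(X-\eta^s)$.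 $g$ is a fixed generator of $\mathbb Z_{\ell^m}^*$, $\lambda(r)=\mathrm{ord}_{\ell^r}(q)$, $\delta(r)=\phi(\ell^r)/\lambda(r)$. If $q\equiv1\pmod4$: $\gamma\in\mathbb F_q$ is a primitive fourth root of unity and $\beta\in\mathbb F_q$ satisfies $\beta^{\ell^m}\gamma=1$ and $\beta^{-1}=-\beta$. If $q\equiv3\pmod4$: $\varsigma\in\mathbb F_{q^2}$ satisfies $\varsigma^2=-1$, and $\theta\in\mathbb F_{q^2}$ satisfies $\theta^{\ell^m}\varsigma=1$ and $\theta^{-1}=\theta^q=-\theta$. *)

theory Defs
  imports "HOL-Number_Theory.Number_Theory" "HOL-Computational_Algebra.Polynomial"
begin

text \<open>The field F_q is realised as the subfield {x. x^q = x} of an ambient finite field 'b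
  (an extension of F_q containing all auxiliary elements eta, beta, gamma, theta, varsigma).\<close>

definition Fq :: "nat \<Rightarrow> 'b::field set" where
  "Fq q = {x. x ^ q = x}"

definition over_Fq :: "nat \<Rightarrow> 'b::field poly \<Rightarrow> bool" where
  "over_Fq q h \<longleftrightarrow> (\<forall>i. coeff h i \<in> Fq q)"

definition xN1 :: "nat \<Rightarrow> 'b::field poly" where
  "xN1 N = monom 1 N + 1"

text \<open>Elements of F_q[X]/(X^N+1) are represented by their reduced representatives
  (polynomials over F_q of degree < N), which are identified with vectors in F_q^N.\<close>
definition reps :: "nat \<Rightarrow> nat \<Rightarrow> 'b::field poly set" where
  "reps q N = {c. over_Fq q c \<and> degree c < N}"

definition negacyclic_code :: "nat \<Rightarrow> nat \<Rightarrow> 'b::field poly set \<Rightarrow> bool" where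
  "negacyclic_code q N C \<longleftrightarrow> C \<subseteq> reps q N \<and> 0 \<in> C \<and>
     (\<forall>x\<in>C. \<forall>y\<in>C. x + y \<in> C) \<and>
     (\<forall>a x. over_Fq q a \<longrightarrow> x \<in> C \<longrightarrow> (a * x) mod xN1 N \<in> C)"

definition gen_code :: "nat \<Rightarrow> nat \<Rightarrow> 'b::field poly \<Rightarrow> 'b poly set" where
  "gen_code q N h = {(a * h) mod xN1 N | a. over_Fq q a}"

definition dual_code :: "nat \<Rightarrow> nat \<Rightarrow> 'b::field poly set \<Rightarrow> 'b poly set" where
  "dual_code q N C = {d \<in> reps q N. \<forall>c\<in>C. (\<Sum>i<N. coeff c i * coeff d i) = 0}"

definition LCD :: "nat \<Rightarrow> nat \<Rightarrow> 'b::field poly set \<Rightarrow> bool" where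
  "LCD q N C \<longleftrightarrow> C \<inter> dual_code q N C = {0}"

definition LCD_negacyclic_codes :: "nat \<Rightarrow> nat \<Rightarrow> 'b::field poly set set" where
  "LCD_negacyclic_codes q N = {C. negacyclic_code q N C \<and> LCD q N C}"

definition cyc_coset :: "nat \<Rightarrow> nat \<Rightarrow> int \<Rightarrow> int set" where
  "cyc_coset q M t = {(t * int q ^ i) mod int M | i. True}"

definition Mpoly :: "'b::field \<Rightarrow> nat \<Rightarrow> nat \<Rightarrow> int \<Rightarrow> 'b poly" where
  "Mpoly \<eta> q M t = (\<Prod>s\<in>cyc_coset q M t. [:- (\<eta> ^ nat s), 1:])"

definition Npoly :: "'b::field \<Rightarrow> nat \<Rightarrow> nat \<Rightarrow> int \<Rightarrow> 'b poly" where
  "Npoly \<eta> q M t = (\<Prod>s\<in>cyc_coset (q^2) M t. [:- (\<eta> ^ nat s), 1:])"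

definition hat :: "'b::field poly \<Rightarrow> 'b poly" where
  "hat h = smult (inverse (lead_coeff h)) h"

definition scaleX :: "'b::field poly \<Rightarrow> 'b \<Rightarrow> 'b poly" where
  "scaleX h c = pcompose h [:0, c:]"

definition prim_root_unity :: "'b::field \<Rightarrow> nat \<Rightarrow> bool" where
  "prim_root_unity \<eta> M \<longleftrightarrow> \<eta> ^ M = 1 \<and> (\<forall>k. 0 < k \<and> k < M \<longrightarrow> \<eta> ^ k \<noteq> 1)"

definition coset_reps :: "nat \<Rightarrow> nat \<Rightarrow> (nat \<Rightarrow> int) \<Rightarrow> nat \<Rightarrow> bool" where
  "coset_reps q M \<rho> e \<longleftrightarrow> \<rho> 0 = 0 \<and> (\<forall>i\<le>e. 0 \<le> \<rho> i \<and> \<rho> i < int M) \<and>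
     (\<forall>i\<le>e. \<forall>j\<le>e. i \<noteq> j \<longrightarrow> cyc_coset q M (\<rho> i) \<noteq> cyc_coset q M (\<rho> j)) \<and>
     (\<forall>t. 0 \<le> t \<and> t < int M \<longrightarrow> (\<exists>i\<le>e. t \<in> cyc_coset q M (\<rho> i)))"

end

theory Submission
  imports Defs
begin

text \<open>
  All roots of \<open>X^N + 1 = (X^(2 l^m) + 1)^(p^n)\<close> lie in the ambient field and have multiplicity
  \<open>p^n\<close>. Reading off coefficient \<open>N - 1\<close> modulo \<open>X^N + 1\<close> turns the Euclidean inner product into a
  product with the reversed polynomial, so the code generated by a divisor with multiplicities
  \<open>a w\<close> meets its dual in the multiples of \<open>\<Prod>w. (X - w)^max (a w) (p^n - a (1/w))\<close>. Hence it is LCD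
  iff \<open>a w = a (1/w) \<in> {0, p^n}\<close> for all \<open>w\<close>: LCD codes correspond to unions of orbits of the roots
  under \<open>w \<mapsto> w^q\<close> and \<open>w \<mapsto> 1/w\<close>. The roots are \<open>\<plusminus>t \<eta>^s\<close> with \<open>t^2 = -1\<close>; inversion sends
  \<open>(sign, s)\<close> to \<open>(-sign, -s)\<close>, and the Frobenius map sends it to \<open>(\<plusminus>sign, q s)\<close> according to
  \<open>q \<equiv> \<plusminus>1 (mod 4)\<close>. The orbits are then governed by whether \<open>-1\<close> is a power of \<open>q\<close> modulo \<open>l^m\<close>,
  and by the parity of the exponent.
\<close>

section \<open>Split polynomials and reversal\<close>

text \<open>Both \<open>\<beta>\<close> and \<open>\<theta>\<close> are square roots of -1, the
  first fixed and the second negated by the \<open>q\<close>-power map, and this determines the four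
  counts. If \<open>t^q = t\<close>, only inversion flips the sign, so each orbit meets the roots of
  one fixed sign in exactly one coset: \<open>e + 1\<close> orbits. If \<open>t^q = -t\<close>, the
  two roots \<open>t\<close>, \<open>-t\<close> form one orbit, the source of \<open>X^2 + 1\<close>
  and of the extra 1 in the exponent of 2; the other orbits depend on \<open>f\<close>. For odd
  \<open>f\<close>, \<open>q\<close> has an odd period modulo \<open>l^m\<close>, so some Frobenius
  power flips the sign alone, while inversion joins the distinct cosets of \<open>u\<close> and
  \<open>-u\<close>: \<open>e/2\<close> orbits. For even \<open>f\<close>, \<open>q^h = -1\<close>
  with \<open>h = (f/2) l^(m-1)\<close>, whose parity is that of \<open>f/2\<close>. If
  \<open>h\<close> is odd, the \<open>h\<close>-th Frobenius power is inversion itself, so inversion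
  joins nothing and each nonzero coset yields two orbits, the roots of \<open>S_k\<close> and of
  \<open>T_k\<close>. If \<open>h\<close> is even, that power negates the exponent alone; composed
  with inversion it flips the sign alone, and \<open>S_k\<close> and \<open>T_k\<close>
  merge.\<close>

lemma linear_power_dvd_mult_cancel:
  fixes u v :: "'b::field poly"
  assumes "[:-w, 1:] ^ k dvd u * v" "poly u w \<noteq> 0"
  shows "[:-w, 1:] ^ k dvd v"
proof (cases "v = 0")
  case False
  moreover have "u \<noteq> 0" using assms(2) by auto
  ultimately have "order w (u * v) = order w v"
    using assms(2) by (simp add: order_mult order_0I)
  with assms \<open>u \<noteq> 0\<close> show ?thesis
    by (auto simp: order_divides)
qed auto

text \<open>Powers at distinct points are coprime: the product collected so far does not vanish at
  the new point, so the new power must divide the cofactor.\<close>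

lemma prod_linear_powers_dvd:
  fixes f :: "'b::field poly"
  assumes "finite A" "\<And>w. w \<in> A \<Longrightarrow> [:-w, 1:] ^ b w dvd f"
  shows "(\<Prod>w\<in>A. [:-w, 1:] ^ b w) dvd f"
  using assms
proof (induction A rule: finite_induct)
  case (insert x A)
  then obtain u where u: "f = (\<Prod>w\<in>A. [:-w, 1:] ^ b w) * u"
    by (auto elim!: dvdE)
  have "poly (\<Prod>w\<in>A. [:-w, 1:] ^ b w) x \<noteq> 0"
    using insert.hyps by (auto simp: poly_prod)
  moreover have "[:-x, 1:] ^ b x dvd (\<Prod>w\<in>A. [:-w, 1:] ^ b w) * u"
    using insert.prems[of x] u by simp
  ultimately have "[:-x, 1:] ^ b x dvd u"
    by (rule linear_power_dvd_mult_cancel[rotated])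
  then show ?case
    using insert.hyps u by (simp add: mult.commute mult_dvd_mono)
qed auto

lemma degree_prod_linear_powers:
  fixes b :: "'b::field \<Rightarrow> nat"
  shows "degree (\<Prod>w\<in>A. [:-w, 1:] ^ b w) = (\<Sum>w\<in>A. b w)"
  by (subst degree_prod_eq_sum_degree) (auto simp: degree_power_eq)

lemma lead_coeff_prod_linear_powers:
  fixes b :: "'b::field \<Rightarrow> nat"
  shows "lead_coeff (\<Prod>w\<in>A. [:-w, 1:] ^ b w) = 1"
  by (simp only: lead_coeff_prod lead_coeff_power) auto

lemma monic_dvd_same_degree_eq:
  fixes f g :: "'b::field poly"
  assumes "f dvd g" "degree g = degree f" "lead_coeff f = 1" "lead_coeff g = 1"
  shows "g = f"
proof -
  obtain u where u: "g = f * u" using assms(1) by blast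
  have nz: "f \<noteq> 0" "u \<noteq> 0" using assms u by auto
  then have "degree u = 0" using u assms(2) by (simp add: degree_mult_eq)
  then obtain c where c: "u = [:c:]" by (meson degree_eq_zeroE)
  then have "lead_coeff g = c * lead_coeff f"
    using u assms(2) by (simp add: mult.commute)
  then have "c = 1" unfolding assms(3,4) by simp
  then show ?thesis using u c by simp
qed

lemma linear_power_dvd_prod_iff:
  fixes b :: "'b::field \<Rightarrow> nat"
  assumes "finite A" "x \<in> A"
  shows "[:-x, 1:] ^ k dvd (\<Prod>w\<in>A. [:-w, 1:] ^ b w) \<longleftrightarrow> k \<le> b x"
proof
  assume *: "[:-x, 1:] ^ k dvd (\<Prod>w\<in>A. [:-w, 1:] ^ b w)"
  have nz: "poly (\<Prod>w\<in>A-{x}. [:-w, 1:] ^ b w) x \<noteq> 0"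
    using assms by (auto simp: poly_prod)
  have "[:-x, 1:] ^ k dvd (\<Prod>w\<in>A-{x}. [:-w, 1:] ^ b w) * [:-x, 1:] ^ b x"
    using * assms by (simp add: prod.remove mult.commute)
  from linear_power_dvd_mult_cancel[OF this nz] show "k \<le> b x"
    by (simp add: order_divides order_power_n_n)
next
  assume "k \<le> b x"
  then have "[:-x, 1:] ^ k dvd [:-x, 1:] ^ b x"
    by (simp add: le_imp_power_dvd)
  also have "\<dots> dvd (\<Prod>w\<in>A. [:-w, 1:] ^ b w)"
    using assms by (intro dvd_prodI)
  finally show "[:-x, 1:] ^ k dvd (\<Prod>w\<in>A. [:-w, 1:] ^ b w)" .
qed

text \<open>Reverses the whole vector of length \<open>N\<close>, zeros above the degree included.
  Unlike \<open>reflect_poly\<close>, this is an involution on polynomials of degree below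
  \<open>N\<close>; the two differ by a power of \<open>X\<close>.\<close>

definition rev_poly :: "nat \<Rightarrow> 'b::field poly \<Rightarrow> 'b poly" where
  "rev_poly N d = (\<Sum>i<N. monom (coeff d i) (N - 1 - i))"

lemma coeff_rev_poly: "coeff (rev_poly N d) j = (if j < N then coeff d (N - 1 - j) else 0)"
proof -
  have "coeff (rev_poly N d) j = (\<Sum>i<N. if N - 1 - i = j then coeff d i else 0)"
    by (simp add: rev_poly_def coeff_sum)
  also have "\<dots> = (\<Sum>i\<in>{..<N} \<inter> {i. N - 1 - i = j}. coeff d i)"
    by (simp add: sum.inter_restrict)
  also have "{..<N} \<inter> {i. N - 1 - i = j} = (if j < N then {N - 1 - j} else {})"
    by auto
  finally show ?thesis by simp
qed

lemma rev_poly_rev_poly: "degree d < N \<Longrightarrow> rev_poly N (rev_poly N d) = d"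
  by (intro poly_eqI) (auto simp: coeff_rev_poly coeff_eq_0)

lemma degree_rev_poly_less: "N > 0 \<Longrightarrow> degree (rev_poly N d) < N"
  by (rule le_less_trans[of _ "N - 1"], rule degree_le) (auto simp: coeff_rev_poly)

lemma rev_poly_conv_reflect_poly:
  assumes "degree d < N"
  shows "rev_poly N d = monom 1 (N - 1 - degree d) * reflect_poly d"
  using assms
  by (intro poly_eqI)
     (auto simp: coeff_rev_poly coeff_monom_mult coeff_reflect_poly coeff_eq_0)

lemma linear_power_dvd_rev_polyI:
  fixes w :: "'b::field"
  assumes "w \<noteq> 0" "degree d < N" "[:-inverse w, 1:] ^ k dvd d"
  shows "[:-w, 1:] ^ k dvd rev_poly N d"
proof -
  obtain u where u: "d = [:-inverse w, 1:] ^ k * u" using assms by blast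
  \<comment> \<open>This is \<open>1 - X/w = -(1/w) (X - w)\<close>: reversal inverts roots.\<close>
  have "reflect_poly [:-inverse w, 1:] = smult (- inverse w) [:-w, 1:]"
    using assms by (simp add: reflect_poly_pCons)
  then have "reflect_poly d = smult (- inverse w) [:-w, 1:] ^ k * reflect_poly u"
    unfolding u by (simp add: reflect_poly_mult reflect_poly_power)
  then have "[:-w, 1:] ^ k dvd reflect_poly d"
    using assms(1) by (simp only: smult_power) (simp add: dvd_smult)
  then show ?thesis
    by (simp add: rev_poly_conv_reflect_poly[OF assms(2)])
qed

text \<open>Reversal is an involution, so the converse is the one-sided lemma at
  \<open>inverse w\<close> and \<open>rev_poly N d\<close>.\<close>

lemma linear_power_dvd_rev_poly_iff:
  fixes w :: "'b::field"
  assumes "w \<noteq> 0" "degree d < N"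
  shows "[:-w, 1:] ^ k dvd rev_poly N d \<longleftrightarrow> [:-inverse w, 1:] ^ k dvd d"
  using linear_power_dvd_rev_polyI[of w d N k] assms
    linear_power_dvd_rev_polyI[of "inverse w" "rev_poly N d" N k]
  by (auto simp: rev_poly_rev_poly degree_rev_poly_less)

section \<open>Residues modulo X^N + 1 and the Euclidean inner product\<close>

lemma degree_xN1: "N > 0 \<Longrightarrow> degree (xN1 N :: 'b::field poly) = N"
  unfolding xN1_def by (subst degree_add_eq_left) (auto simp: degree_monom_eq)

lemma lead_coeff_xN1: "N > 0 \<Longrightarrow> lead_coeff (xN1 N :: 'b::field poly) = 1"
  unfolding degree_xN1 by (simp add: xN1_def)

lemma xN1_nonzero: "N > 0 \<Longrightarrow> xN1 N \<noteq> (0 :: 'b::field poly)"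
  using lead_coeff_xN1[of N, where ?'b = 'b] by auto

lemma degree_mod_xN1: "N > 0 \<Longrightarrow> degree (f mod xN1 N :: 'b::field poly) < N"
  using degree_mod_less'[of "xN1 N" f] degree_xN1[of N, where ?'b = 'b]
  by (cases "f mod xN1 N = 0") (auto simp: xN1_nonzero)

text \<open>Reduction changes the coefficient at \<open>N - 1\<close> only by folding the one at
  \<open>2 N - 1\<close> onto it with a sign, and the degree bound excludes that term.\<close>

lemma coeff_mod_xN1_last:
  fixes f :: "'b::field poly"
  assumes "N > 0" "degree f < 2 * N - 1"
  shows "coeff (f mod xN1 N) (N - 1) = coeff f (N - 1)"
proof -
  define u where "u = f div xN1 N"
  \<comment> \<open>The zero quotient is kept apart because for \<open>N = 1\<close> the strict
    inequality is impossible.\<close>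
  have "degree u < N - 1 \<or> u = 0"
  proof (cases "u = 0")
    case False
    have "degree (u * xN1 N) = degree u + N"
      using False assms by (simp add: degree_mult_eq xN1_nonzero degree_xN1)
    moreover have "u * xN1 N = f - f mod xN1 N"
      by (simp add: u_def minus_mod_eq_div_mult)
    moreover have "degree (f - f mod xN1 N) < 2 * N - 1"
      using assms degree_mod_xN1[of N f] by (intro degree_diff_less) auto
    ultimately show ?thesis by auto
  qed auto
  then have "coeff u (N - 1) = 0" by (auto simp: coeff_eq_0)
  moreover have "f = monom 1 N * u + u + f mod xN1 N"
    using div_mult_mod_eq[of f "xN1 N"] unfolding u_def xN1_def by (simp add: algebra_simps)
  then have "coeff f (N - 1) = coeff (monom 1 N * u + u + f mod xN1 N) (N - 1)" by metis
  ultimately show ?thesis using assms by (auto simp: coeff_monom_mult)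
qed

text \<open>The coefficient at \<open>N - 1\<close> of a product pairs complementary indices, and
  reversing one factor turns these into equal ones. The product has degree at most
  \<open>2 N - 2\<close>, so reduction leaves this coefficient alone.\<close>

lemma inner_product_conv_rev_poly:
  fixes c d :: "'b::field poly"
  assumes "degree c < N"
  shows "(\<Sum>i<N. coeff c i * coeff d i) = coeff ((c * rev_poly N d) mod xN1 N) (N - 1)"
proof -
  have N: "N > 0" using assms by simp
  have "degree (c * rev_poly N d) < 2 * N - 1"
    using degree_mult_le[of c "rev_poly N d"] degree_rev_poly_less[OF N, of d] assms by linarith
  then have "coeff ((c * rev_poly N d) mod xN1 N) (N - 1) = coeff (c * rev_poly N d) (N - 1)"
    using coeff_mod_xN1_last N by blast
  also have "\<dots> = (\<Sum>i\<le>N - 1. coeff c i * coeff (rev_poly N d) (N - 1 - i))"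
    by (simp add: coeff_mult)
  also have "\<dots> = (\<Sum>i<N. coeff c i * coeff d i)"
    using N by (intro sum.cong) (auto simp: coeff_rev_poly)
  finally show ?thesis by simp
qed

text \<open>The coefficient of \<open>X^(N-1)\<close> is a nondegenerate functional on the quotient ring.\<close>

lemma orthogonal_gen_code_iff:
  fixes h d :: "'b::field poly"
  assumes N: "N > 0" and q: "q > 0"
  shows "(\<forall>c\<in>gen_code q N h. (\<Sum>i<N. coeff c i * coeff d i) = 0)
    \<longleftrightarrow> xN1 N dvd h * rev_poly N d" (is "?lhs \<longleftrightarrow> _")
proof -
  have eq: "(\<Sum>i<N. coeff ((a * h) mod xN1 N) i * coeff d i)
      = coeff ((a * (h * rev_poly N d mod xN1 N)) mod xN1 N) (N - 1)" for a
    by (subst inner_product_conv_rev_poly[OF degree_mod_xN1[OF N]])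
       (simp add: mod_mult_left_eq mod_mult_right_eq mult.assoc)
  have lhs: "?lhs \<longleftrightarrow> (\<forall>a. over_Fq q a \<longrightarrow>
      coeff ((a * (h * rev_poly N d mod xN1 N)) mod xN1 N) (N - 1) = 0)"
    unfolding gen_code_def by (auto simp: eq)
  define r where "r = h * rev_poly N d mod xN1 N"
  have "r = 0" if "\<forall>a. over_Fq q a \<longrightarrow> coeff ((a * r) mod xN1 N) (N - 1) = 0"
  proof (rule ccontr)
    assume r: "r \<noteq> 0"
    have dr: "degree r < N" unfolding r_def by (rule degree_mod_xN1[OF N])
    \<comment> \<open>This multiplier shifts the leading term of \<open>r\<close> to position
      \<open>N - 1\<close>, where the functional reads off its nonzero coefficient; no reduction
      takes place.\<close>
    let ?a = "monom 1 (N - 1 - degree r) :: 'b poly"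
    have "over_Fq q ?a" using q by (auto simp: over_Fq_def Fq_def)
    moreover have "degree (?a * r) = N - 1"
      using r dr by (simp add: degree_mult_eq degree_monom_eq)
    then have "(?a * r) mod xN1 N = ?a * r"
      using N by (intro mod_poly_less) (simp add: degree_xN1)
    ultimately have "coeff (?a * r) (N - 1) = 0" using that by metis
    moreover have "N - 1 - (N - 1 - degree r) = degree r" "\<not> N - 1 < N - 1 - degree r"
      using dr by simp_all
    ultimately show False using r by (simp only: coeff_monom_mult) simp
  qed
  then show ?thesis unfolding lhs r_def[symmetric] using r_def by auto
qed

section \<open>LCD codes and stable sets of roots\<close>

text \<open>The equation \<open>card R = K\<close> says that \<open>X^K + 1\<close> splits into
  distinct linear factors over the ambient field. The application has
  \<open>K = 2 l^m\<close>.\<close>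

locale split_negacyclic =
  fixes p q n K :: nat and R :: "'b::{field, finite} set"
  assumes char: "CHAR('b) = p" and prime_p: "prime p" and q_power: "\<exists>a. q = p ^ a"
    and K_pos: "K > 0" and R_def: "R = {w. w ^ K = -1}" and card_R: "card R = K"
begin

abbreviation "N \<equiv> K * p ^ n"

definition root_prod :: "'b set \<Rightarrow> 'b poly" where
  "root_prod A = (\<Prod>w\<in>A. [:-w, 1:])"

text \<open>Being defined over \<open>F_q\<close> becomes a fixed-point equation for this ring
  automorphism, so no polynomial ring over a separate subfield type has to be handled.\<close>

definition Frob :: "'b poly \<Rightarrow> 'b poly" where
  "Frob = map_poly (\<lambda>x. x ^ q)"

definition stable :: "'b set \<Rightarrow> bool" where
  "stable A \<longleftrightarrow> A \<subseteq> R \<and> (\<forall>w\<in>A. w ^ q \<in> A \<and> inverse w \<in> A)"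

lemma p_pos: "p > 0" and q_pos: "q > 0" and N_pos: "N > 0"
  using prime_p q_power K_pos by (auto simp: prime_gt_0_nat)

lemma root_nonzero: "w \<in> R \<Longrightarrow> w \<noteq> 0"
  using K_pos by (auto simp: R_def power_0_left)

lemma inverse_root: "w \<in> R \<Longrightarrow> inverse w \<in> R"
  by (simp add: R_def power_inverse)

lemma power_q_sum: "(\<Sum>i\<in>A. f i :: 'b) ^ q = (\<Sum>i\<in>A. f i ^ q)"
proof -
  obtain a where "q = p ^ a" using q_power by blast
  then show ?thesis
    using freshmans_dream_sum'[where ?'a = 'b, of q a f A] char prime_p by simp
qed

lemma power_q_add: "(x + y :: 'b) ^ q = x ^ q + y ^ q"
proof -
  obtain a where "q = p ^ a" using q_power by blast
  then show ?thesis
    using freshmans_dream'[where ?'a = 'b, of q a x y] char prime_p by simp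
qed

lemma power_q_minus: "(- x :: 'b) ^ q = - (x ^ q)"
  using power_q_add[of x "-x"] q_pos by (simp add: power_0_left eq_neg_iff_add_eq_0 add.commute)

lemma power_q_inj: "(x :: 'b) ^ q = y ^ q \<longleftrightarrow> x = y"
proof
  assume "x ^ q = y ^ q"
  then have "(x - y) ^ q = 0"
    using power_q_add[of x "-y"] by (simp add: power_q_minus)
  then show "x = y" by simp
qed simp

lemma power_q_root: "w \<in> R \<Longrightarrow> w ^ q \<in> R"
  using power_q_minus[of 1] by (simp add: R_def power_mult[symmetric] mult.commute)
    (simp add: power_mult)

text \<open>An injective self-map of a finite set is onto; forward closure therefore gives backward
  closure.\<close>

lemma stable_power_q_image:
  assumes "stable A"
  shows "(\<lambda>w. w ^ q) ` A = A"
  using assms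
  by (intro card_subset_eq) (auto simp: stable_def card_image inj_on_def power_q_inj)

lemma stable_power_q_iff:
  assumes "stable A"
  shows "w ^ q \<in> A \<longleftrightarrow> w \<in> A"
proof
  assume "w ^ q \<in> A"
  then have "w ^ q \<in> (\<lambda>w. w ^ q) ` A" by (simp add: stable_power_q_image[OF assms])
  then show "w \<in> A" by (auto simp: power_q_inj)
qed (use assms in \<open>simp add: stable_def\<close>)

lemma stable_R: "stable R"
  by (simp add: stable_def power_q_root inverse_root)

section \<open>Frobenius on coefficients and descent to F_q\<close>

lemma coeff_Frob [simp]: "coeff (Frob h) i = coeff h i ^ q"
  using q_pos by (simp add: Frob_def coeff_map_poly)

lemma over_Fq_iff_Frob: "over_Fq q h \<longleftrightarrow> Frob h = h"
  by (auto simp: over_Fq_def Fq_def poly_eq_iff)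

lemma Frob_add: "Frob (f + g) = Frob f + Frob g"
  by (intro poly_eqI) (simp add: power_q_add)

lemma Frob_mult: "Frob (f * g) = Frob f * Frob g"
  by (intro poly_eqI) (simp add: coeff_mult power_q_sum power_mult_distrib)

lemma Frob_1 [simp]: "Frob 1 = 1"
  by (simp add: Frob_def)

lemma Frob_power: "Frob (f ^ k) = Frob f ^ k"
  by (induction k) (auto simp: Frob_mult)

lemma Frob_prod: "Frob (\<Prod>i\<in>A. f i) = (\<Prod>i\<in>A. Frob (f i))"
  by (induction A rule: infinite_finite_induct) (auto simp: Frob_mult)

lemma Frob_linear: "Frob [:-w, 1:] = [:-(w ^ q), 1:]"
  using q_pos by (simp add: Frob_def map_poly_pCons power_q_minus)

lemma degree_Frob [simp]: "degree (Frob f) = degree f"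
  using q_pos by (cases "f = 0") (auto simp: Frob_def intro!: map_poly_degree_eq)

lemma Frob_eq_iff: "Frob f = Frob g \<longleftrightarrow> f = g"
  by (simp add: poly_eq_iff power_q_inj)

lemma Frob_surj: "\<exists>g. f = Frob g"
proof -
  have "surj (\<lambda>x::'b. x ^ q)"
    by (intro finite_UNIV_inj_surj) (auto simp: inj_def power_q_inj)
  then have "(inv_into UNIV (\<lambda>x::'b. x ^ q) x) ^ q = x" for x
    by (metis surj_f_inv_f)
  \<comment> \<open>A coefficientwise map yields a polynomial with the expected coefficients only if
    it fixes 0, so the inverse map is checked there.\<close>
  moreover from this[of 0] have "inv_into UNIV (\<lambda>x::'b. x ^ q) 0 = 0"
    using q_pos by simp
  ultimately have "f = Frob (map_poly (inv_into UNIV (\<lambda>x::'b. x ^ q)) f)"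
    by (intro poly_eqI) (simp add: coeff_map_poly)
  then show ?thesis ..
qed

lemma Frob_dvd_iff: "Frob f dvd Frob g \<longleftrightarrow> f dvd g"
proof
  assume "Frob f dvd Frob g"
  then obtain u where "Frob g = Frob f * Frob u" using Frob_surj by (metis dvdE)
  then have "g = f * u" by (simp add: Frob_eq_iff flip: Frob_mult)
  then show "f dvd g" by simp
next
  assume "f dvd g"
  then show "Frob f dvd Frob g" by (auto simp: Frob_mult)
qed

lemma over_Fq_add:
  fixes f g :: "'b poly"
  shows "over_Fq q f \<Longrightarrow> over_Fq q g \<Longrightarrow> over_Fq q (f + g)"
  by (simp add: over_Fq_iff_Frob Frob_add)

lemma over_Fq_mult:
  fixes f g :: "'b poly"
  shows "over_Fq q f \<Longrightarrow> over_Fq q g \<Longrightarrow> over_Fq q (f * g)"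
  by (simp add: over_Fq_iff_Frob Frob_mult)

text \<open>Applying \<open>Frob\<close> to the division of \<open>f\<close> by \<open>g\<close>
  gives a second division with the same \<open>f\<close> and \<open>g\<close> and a remainder of the
  same degree; uniqueness of remainders makes the remainder a fixed point.\<close>

lemma over_Fq_mod:
  fixes f g :: "'b poly"
  assumes "over_Fq q f" "over_Fq q g"
  shows "over_Fq q (f mod g)"
proof (cases "g = 0 \<or> f mod g = 0")
  case False
  have "Frob f = Frob (f div g) * Frob g + Frob (f mod g)"
    by (simp flip: Frob_mult Frob_add)
  then have "Frob (f mod g) = f - Frob (f div g) * g"
    using assms by (simp add: over_Fq_iff_Frob algebra_simps)
  moreover have "degree (Frob (f mod g)) < degree g"
    using False by (simp add: degree_mod_less')
  then have "Frob (f mod g) = Frob (f mod g) mod g"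
    by (simp add: mod_poly_less)
  ultimately have "Frob (f mod g) = (f - Frob (f div g) * g) mod g" by simp
  also have "\<dots> = f mod g"
    by (metis mod_mult_self2_is_0 mod_diff_right_eq diff_zero)
  finally show ?thesis by (simp add: over_Fq_iff_Frob)
qed (use assms q_pos in \<open>auto simp: over_Fq_def Fq_def power_0_left\<close>)

text \<open>Applying \<open>Frob\<close> gives \<open>h * u = h * Frob u\<close>, and
  \<open>h\<close> cancels.\<close>

lemma over_Fq_cofactor:
  fixes h u :: "'b poly"
  assumes "over_Fq q (h * u)" "over_Fq q h" "h \<noteq> 0"
  shows "over_Fq q u"
  using assms by (simp add: over_Fq_iff_Frob Frob_mult)

lemma over_Fq_xN1: "over_Fq q (xN1 k :: 'b poly)"
  using q_pos by (simp add: over_Fq_iff_Frob xN1_def Frob_add) (simp add: Frob_def map_poly_monom)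

lemma xN1_eq_root_prod: "xN1 K = root_prod R"
proof (rule monic_dvd_same_degree_eq)
  have "poly (xN1 K) w = 0" if "w \<in> R" for w
    using that by (simp add: xN1_def R_def poly_monom)
  then have "(\<Prod>w\<in>R. [:-w, 1:] ^ 1) dvd xN1 K"
    by (intro prod_linear_powers_dvd) (auto simp: poly_eq_0_iff_dvd)
  then show "root_prod R dvd xN1 K" by (simp add: root_prod_def)
  show "degree (xN1 K) = degree (root_prod R)"
    using degree_prod_linear_powers[of "\<lambda>_. 1" R] K_pos card_R
    by (simp add: root_prod_def degree_xN1)
  show "lead_coeff (root_prod R) = 1"
    using lead_coeff_prod_linear_powers[of "\<lambda>_. 1" R] by (simp add: root_prod_def)
  show "lead_coeff (xN1 K) = 1" using K_pos by (rule lead_coeff_xN1)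
qed

lemma xN1_N: "xN1 N = (\<Prod>w\<in>R. [:-w, 1:] ^ (p ^ n))"
proof -
  have "xN1 N = (xN1 K :: 'b poly) ^ (p ^ n)"
    using freshmans_dream'[where ?'a = "'b poly", of "p ^ n" n "monom 1 K" 1] char prime_p
    by (simp add: xN1_def monom_power mult.commute)
  then show ?thesis by (simp add: xN1_eq_root_prod root_prod_def prod_power_distrib)
qed

lemma root_prod_power: "root_prod A ^ k = (\<Prod>w\<in>A. [:-w, 1:] ^ k)"
  by (simp add: root_prod_def prod_power_distrib)

lemma root_prod_Un: "A \<inter> B = {} \<Longrightarrow> root_prod (A \<union> B) = root_prod A * root_prod B"
  unfolding root_prod_def by (rule prod.union_disjoint) auto

text \<open>Frobenius permutes \<open>R\<close>, so it only reorders the factors when multiplicities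
  are constant along \<open>w \<mapsto> w^q\<close>. General exponents are allowed because the
  witness in \<open>LCD_orders\<close> has multiplicities other than 0 and
  \<open>p^n\<close>.\<close>

lemma over_Fq_invariant_prod:
  assumes "\<And>w. w \<in> R \<Longrightarrow> b (w ^ q) = (b w :: nat)"
  shows "over_Fq q (\<Prod>w\<in>R. [:-w, 1:] ^ b w)"
proof -
  have "Frob (\<Prod>w\<in>R. [:-w, 1:] ^ b w) = (\<Prod>w\<in>R. [:-(w ^ q), 1:] ^ b (w ^ q))"
    unfolding Frob_prod using assms by (intro prod.cong) (simp_all only: Frob_power Frob_linear)
  also have "\<dots> = (\<Prod>w\<in>(\<lambda>w. w ^ q) ` R. [:-w, 1:] ^ b w)"
    by (subst prod.reindex) (auto simp: inj_on_def power_q_inj)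
  finally show ?thesis
    using stable_power_q_image[OF stable_R] by (simp add: over_Fq_iff_Frob)
qed

lemma over_Fq_root_prod_power:
  assumes "stable A"
  shows "over_Fq q (root_prod A ^ k)"
proof -
  have "root_prod A ^ k = (\<Prod>w\<in>R. [:-w, 1:] ^ (if w \<in> A then k else 0))"
    using assms unfolding root_prod_power
    by (intro prod.mono_neutral_cong_left) (auto simp: stable_def)
  then show ?thesis by (simp add: over_Fq_invariant_prod stable_power_q_iff[OF assms])
qed

section \<open>Negacyclic codes as principal ideals\<close>

lemma gen_code_eq:
  fixes h :: "'b poly"
  assumes "over_Fq q h" "h dvd xN1 N"
  shows "gen_code q N h = {c \<in> reps q N. h dvd c}"
proof (intro equalityI subsetI)
  fix c assume "c \<in> gen_code q N h"
  then obtain a where a: "over_Fq q a" "c = (a * h) mod xN1 N"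
    by (auto simp: gen_code_def)
  then show "c \<in> {c \<in> reps q N. h dvd c}"
    using assms N_pos
    by (auto simp: reps_def over_Fq_mod over_Fq_mult over_Fq_xN1 degree_mod_xN1 dvd_mod)
next
  fix c assume c: "c \<in> {c \<in> reps q N. h dvd c}"
  have "h \<noteq> 0" using assms(2) xN1_nonzero[OF N_pos, where ?'b = 'b] by auto
  obtain u where u: "c = h * u" using c by blast
  have "over_Fq q u"
    using c u assms \<open>h \<noteq> 0\<close> over_Fq_cofactor by (auto simp: reps_def)
  moreover have "c mod xN1 N = c"
    using c N_pos by (intro mod_poly_less) (simp add: reps_def degree_xN1)
  ultimately show "c \<in> gen_code q N h"
    using u unfolding gen_code_def by (auto simp: mult.commute intro!: exI[of _ u])
qed

lemma negacyclic_code_gen_code: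
  fixes h :: "'b poly"
  assumes "over_Fq q h" "h dvd xN1 N"
  shows "negacyclic_code q N (gen_code q N h)"
  unfolding negacyclic_code_def gen_code_eq[OF assms]
  using assms q_pos N_pos K_pos
  by (auto simp: reps_def over_Fq_add over_Fq_mod over_Fq_mult over_Fq_xN1 degree_mod_xN1
      dvd_mod degree_add_less over_Fq_def[of q 0] Fq_def power_0_left)

text \<open>The division argument of a principal ideal domain, run on the preimage \<open>I\<close>
  of the code in \<open>F_q[X]\<close>. Since \<open>I\<close> contains \<open>X^N + 1\<close>, its
  monic element of least degree divides \<open>X^N + 1\<close>. Every quotient formed on the way
  must be shown to lie over \<open>F_q\<close>.\<close>

lemma negacyclic_code_principal:
  fixes C :: "'b poly set"
  assumes C: "negacyclic_code q N C"
  obtains h :: "'b poly"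
  where "over_Fq q h" "lead_coeff h = 1" "h dvd xN1 N" "C = gen_code q N h"
proof -
  define I where "I = {f. over_Fq q f \<and> f mod xN1 N \<in> C}"
  have C0: "0 \<in> C" and Cadd: "x \<in> C \<Longrightarrow> y \<in> C \<Longrightarrow> x + y \<in> C"
    and Cmult: "over_Fq q a \<Longrightarrow> x \<in> C \<Longrightarrow> (a * x) mod xN1 N \<in> C"
    and Creps: "C \<subseteq> reps q N" for x y a
    using C by (auto simp: negacyclic_code_def)
  have Iadd: "f + g \<in> I" if "f \<in> I" "g \<in> I" for f g
    using that Cadd by (auto simp: I_def over_Fq_add poly_mod_add_left)
  have Imult: "a * f \<in> I" if "over_Fq q a" "f \<in> I" for a f
    using that Cmult[of a "f mod xN1 N"] by (auto simp: I_def over_Fq_mult mod_mult_right_eq)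
  have const: "over_Fq q [:c:]" if "c ^ q = c" for c :: 'b
    using that q_pos by (auto simp: over_Fq_def Fq_def coeff_pCons power_0_left split: nat.splits)
  have IP: "xN1 N \<in> I" using C0 by (simp add: I_def over_Fq_xN1)
  define k where "k = (LEAST k. \<exists>f\<in>I. f \<noteq> 0 \<and> degree f = k)"
  have "\<exists>f\<in>I. f \<noteq> 0 \<and> degree f = k"
    unfolding k_def
    by (rule LeastI_ex, rule exI[of _ N], rule bexI[OF _ IP])
       (use N_pos in \<open>simp add: xN1_nonzero degree_xN1\<close>)
  then obtain f where f: "f \<in> I" "f \<noteq> 0" "degree f = k" by blast
  define h where "h = [:inverse (lead_coeff f):] * f"
  \<comment> \<open>The leading coefficient lies in \<open>F_q\<close>, so making \<open>f\<close>
    monic does not leave \<open>I\<close>.\<close>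
  have "lead_coeff f ^ q = lead_coeff f"
    using f(1) by (simp add: I_def over_Fq_def Fq_def)
  then have hI: "h \<in> I"
    unfolding h_def using f(1) by (intro Imult const) (simp_all add: power_inverse)
  have h: "over_Fq q h" "degree h = k" "lead_coeff h = 1" "h \<noteq> 0"
    using hI f by (auto simp: h_def I_def)
  have hdvd: "h dvd u" if "u \<in> I" for u
  proof (rule ccontr)
    assume "\<not> h dvd u"
    then have nz: "u mod h \<noteq> 0" by (simp add: mod_eq_0_iff_dvd)
    have over: "over_Fq q (u mod h)" using that h by (auto simp: I_def over_Fq_mod)
    \<comment> \<open>The quotient is reached as a cofactor, from \<open>u\<close> minus its
      remainder. Subtraction is written with the constant polynomial -1 because the closure rules
      concern sums and products.\<close>
    have "over_Fq q (h * (u div h))"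
    proof -
      have "h * (u div h) = u + [:-1:] * (u mod h)"
        by (simp add: minus_mod_eq_mult_div[symmetric])
      moreover have "over_Fq q ([:-1:] * (u mod h))"
        using over power_q_minus[of 1] by (intro over_Fq_mult const) auto
      ultimately show ?thesis
        using that by (simp only: I_def mem_Collect_eq over_Fq_add)
    qed
    then have "over_Fq q (u div h)" using over_Fq_cofactor h by blast
    then have "([:-1:] * (u div h)) * h \<in> I"
      using hI power_q_minus[of 1] by (intro Imult over_Fq_mult const) auto
    then have "u + ([:-1:] * (u div h)) * h \<in> I" using that Iadd by blast
    also have "u + ([:-1:] * (u div h)) * h = u mod h"
      by (simp add: minus_div_mult_eq_mod[symmetric])
    finally have "k \<le> degree (u mod h)" unfolding k_def using nz by (intro Least_le) blast
    then show False using degree_mod_less'[of h u] nz h by simp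
  qed
  have P: "h dvd xN1 N" using hdvd IP by blast
  have mod_id: "c mod xN1 N = c" if "c \<in> reps q N" for c
    using that N_pos by (intro mod_poly_less) (simp add: reps_def degree_xN1)
  have "C = {c \<in> reps q N. h dvd c}"
  proof (intro equalityI subsetI)
    fix c assume "c \<in> C"
    moreover from this have c: "c \<in> reps q N" using Creps by blast
    ultimately have "c \<in> I" using mod_id[OF c] by (auto simp: I_def reps_def)
    then show "c \<in> {c \<in> reps q N. h dvd c}" using hdvd c by blast
  next
    fix c assume c: "c \<in> {c \<in> reps q N. h dvd c}"
    then obtain u where u: "c = h * u" by blast
    then have "over_Fq q u" using c h over_Fq_cofactor by (auto simp: reps_def)
    then have "c \<in> I" using u Imult[OF _ hI] by (simp add: mult.commute[of h])
    moreover have "c mod xN1 N = c" using c mod_id by blast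
    ultimately show "c \<in> C" by (simp add: I_def)
  qed
  then show ?thesis using that[OF h(1,3) P] gen_code_eq[OF h(1) P] by simp
qed

section \<open>The intersection of a code with its dual\<close>

lemma LCD_gen_code_iff:
  fixes h :: "'b poly"
  assumes "over_Fq q h" "h dvd xN1 N"
  shows "LCD q N (gen_code q N h) \<longleftrightarrow>
    (\<forall>d\<in>reps q N. h dvd d \<longrightarrow> xN1 N dvd h * rev_poly N d \<longrightarrow> d = 0)"
proof -
  have "0 \<in> reps q N"
    using q_pos K_pos p_pos by (simp add: reps_def over_Fq_def Fq_def)
  then show ?thesis
    unfolding LCD_def dual_code_def orthogonal_gen_code_iff[OF N_pos q_pos]
    by (auto simp: gen_code_eq[OF assms] rev_poly_def)
qed

lemma xN1_dvdI:
  fixes f :: "'b poly"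
  assumes "\<And>w. w \<in> R \<Longrightarrow> [:-w, 1:] ^ (p ^ n) dvd f"
  shows "xN1 N dvd f"
  unfolding xN1_N using assms by (intro prod_linear_powers_dvd) auto

lemma xN1_dvdD:
  fixes f :: "'b poly"
  assumes "xN1 N dvd f" "w \<in> R"
  shows "[:-w, 1:] ^ (p ^ n) dvd f"
proof -
  have "[:-w, 1:] ^ (p ^ n) dvd xN1 N"
    unfolding xN1_N using assms(2) by (subst linear_power_dvd_prod_iff) auto
  then show ?thesis using assms(1) dvd_trans by blast
qed

lemma root_prod_power_dvd_xN1: "A \<subseteq> R \<Longrightarrow> root_prod A ^ (p ^ n) dvd xN1 N"
  unfolding xN1_N root_prod_power by (intro prod_dvd_prod_subset) auto

text \<open>A common element \<open>d\<close> has full multiplicity at \<open>w\<close> in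
  \<open>A\<close> because the generator divides it. For \<open>w\<close> outside \<open>A\<close>
  the generator does not vanish at \<open>1/w\<close> either, so orthogonality puts the full
  multiplicity at \<open>1/w\<close> on the reversed \<open>d\<close>, that is, at \<open>w\<close>
  on \<open>d\<close>. Hence \<open>X^N + 1\<close> divides \<open>d\<close>, whose degree is below
  \<open>N\<close>.\<close>

lemma LCD_stable:
  assumes "stable A"
  shows "LCD q N (gen_code q N (root_prod A ^ (p ^ n)))"
proof -
  have AR: "A \<subseteq> R" using assms by (simp add: stable_def)
  show ?thesis
    unfolding LCD_gen_code_iff[OF over_Fq_root_prod_power[OF assms] root_prod_power_dvd_xN1[OF AR]]
  proof (intro ballI impI)
    fix d assume d: "d \<in> reps q N" "root_prod A ^ (p ^ n) dvd d"
      "xN1 N dvd root_prod A ^ (p ^ n) * rev_poly N d"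
    have "[:-w, 1:] ^ (p ^ n) dvd d" if "w \<in> R" for w
    proof (cases "w \<in> A")
      case True
      then have "[:-w, 1:] ^ (p ^ n) dvd root_prod A ^ (p ^ n)"
        unfolding root_prod_power by (subst linear_power_dvd_prod_iff) auto
      then show ?thesis using d(2) dvd_trans by blast
    next
      case False
      then have w: "inverse w \<notin> A" using assms unfolding stable_def by (metis inverse_inverse_eq)
      then have "poly (root_prod A ^ (p ^ n)) (inverse w) \<noteq> 0"
        by (auto simp: root_prod_def poly_power poly_prod)
      then have "[:-inverse w, 1:] ^ (p ^ n) dvd rev_poly N d"
        using xN1_dvdD[OF d(3) inverse_root[OF that]] linear_power_dvd_mult_cancel by blast
      then show ?thesis
        using linear_power_dvd_rev_poly_iff[of "inverse w" d N "p ^ n"] root_nonzero[OF that] d(1)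
        by (simp add: reps_def)
    qed
    then have "xN1 N dvd d" by (rule xN1_dvdI)
    then show "d = 0"
      using d(1) dvd_imp_degree_le[of "xN1 N" d] degree_xN1[OF N_pos, where ?'b = 'b]
      by (force simp: reps_def)
  qed
qed

text \<open>\<open>Frob\<close> fixes \<open>h\<close> and carries \<open>(X - w)^k\<close> to
  \<open>(X - w^q)^k\<close>.\<close>

lemma order_root_Frob:
  fixes h :: "'b poly"
  assumes "over_Fq q h" "h \<noteq> 0"
  shows "order (w ^ q) h = order w h"
proof -
  have "[:-(w ^ q), 1:] ^ k dvd h \<longleftrightarrow> [:-w, 1:] ^ k dvd h" for k
    using Frob_dvd_iff[of "[:-w, 1:] ^ k" h] assms(1)
    by (simp add: Frob_power Frob_linear over_Fq_iff_Frob)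
  then have "k \<le> order (w ^ q) h \<longleftrightarrow> k \<le> order w h" for k
    using assms(2) by (simp add: order_divides)
  then show ?thesis by (meson order_antisym order_refl)
qed

text \<open>A degree count with the cofactor \<open>v\<close>: over \<open>R\<close> the orders of
  \<open>h\<close> and \<open>v\<close> add up to at least \<open>N = degree h + degree v\<close>,
  while each sum is bounded by its own degree. So both bounds are attained.\<close>

lemma divisor_eq_prod_orders:
  assumes "lead_coeff h = 1" "h dvd xN1 N"
  shows "h = (\<Prod>w\<in>R. [:-w, 1:] ^ order w h)"
proof (rule monic_dvd_same_degree_eq)
  obtain v where v: "xN1 N = h * v" using assms(2) by blast
  have nz: "h \<noteq> 0" "v \<noteq> 0" using v xN1_nonzero[OF N_pos, where ?'b = 'b] by auto
  have dvd: "(\<Prod>w\<in>R. [:-w, 1:] ^ order w u) dvd u" for u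
    by (intro prod_linear_powers_dvd) (auto simp: order_1)
  have le: "(\<Sum>w\<in>R. order w u) \<le> degree u" if "u \<noteq> 0" for u
    using dvd_imp_degree_le[OF dvd that] by (simp add: degree_prod_linear_powers)
  have "order w (xN1 N) \<ge> p ^ n" if "w \<in> R" for w
    using xN1_dvdD[of "xN1 N" w] that xN1_nonzero[OF N_pos, where ?'b = 'b]
    by (simp add: order_divides)
  then have "(\<Sum>w\<in>R. p ^ n) \<le> (\<Sum>w\<in>R. order w (h * v))"
    unfolding v by (rule sum_mono)
  also have "\<dots> = (\<Sum>w\<in>R. order w h) + (\<Sum>w\<in>R. order w v)"
    using nz by (simp add: order_mult sum.distrib)
  finally have "N \<le> (\<Sum>w\<in>R. order w h) + (\<Sum>w\<in>R. order w v)"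
    using card_R by simp
  moreover have "N = degree h + degree v"
    using v nz degree_xN1[OF N_pos, where ?'b = 'b] by (simp add: degree_mult_eq)
  ultimately have "degree h = (\<Sum>w\<in>R. order w h)"
    using le[OF nz(1)] le[OF nz(2)] by linarith
  then show "degree h = degree (\<Prod>w\<in>R. [:-w, 1:] ^ order w h)"
    by (simp only: degree_prod_linear_powers)
  show "(\<Prod>w\<in>R. [:-w, 1:] ^ order w h) dvd h" by (rule dvd)
  show "lead_coeff (\<Prod>w\<in>R. [:-w, 1:] ^ order w h) = 1"
    by (rule lead_coeff_prod_linear_powers)
qed (use assms in auto)

text \<open>The polynomial \<open>G\<close> reduces to an element of the code and of its dual. The
  LCD property kills it, so \<open>X^N + 1\<close> divides \<open>G\<close>, and the multiplicity of
  \<open>G\<close> at \<open>w\<close> is the maximum in question.\<close>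

lemma LCD_orders:
  assumes h: "over_Fq q h" "lead_coeff h = 1" "h dvd xN1 N"
    and lcd: "LCD q N (gen_code q N h)" and w: "w \<in> R"
  shows "p ^ n \<le> max (order w h) (p ^ n - order (inverse w) h)"
proof -
  \<comment> \<open>The first entry makes \<open>h\<close> divide \<open>G\<close>. The second, read
    at \<open>1/w\<close>, gives the reversed residue of \<open>G\<close> the multiplicity at
    \<open>w\<close> that \<open>h\<close> lacks.\<close>
  define b where "b = (\<lambda>w. max (order w h) (p ^ n - order (inverse w) h))"
  define G where "G = (\<Prod>w\<in>R. [:-w, 1:] ^ b w)"
  have hnz: "h \<noteq> 0" using h(2) by auto
  have "b (w ^ q) = b w" for w
    using order_root_Frob[OF h(1) hnz] by (simp add: b_def power_inverse[symmetric])
  then have G_over: "over_Fq q G" unfolding G_def by (rule over_Fq_invariant_prod)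
  define d where "d = G mod xN1 N"
  have d_reps: "d \<in> reps q N"
    using G_over N_pos by (simp add: d_def reps_def over_Fq_mod over_Fq_xN1 degree_mod_xN1)
  have "h dvd G"
    by (subst divisor_eq_prod_orders[OF h(2,3)], unfold G_def, rule prod_dvd_prod)
       (simp add: b_def le_imp_power_dvd)
  then have "h dvd d" unfolding d_def using h(3) by (rule dvd_mod)
  moreover have "xN1 N dvd h * rev_poly N d"
  proof (rule xN1_dvdI)
    fix w assume w: "w \<in> R"
    let ?k = "p ^ n - order w h"
    have "[:-inverse w, 1:] ^ ?k dvd G"
      unfolding G_def using inverse_root[OF w] by (subst linear_power_dvd_prod_iff) (auto simp: b_def)
    \<comment> \<open>As \<open>?k\<close> is at most \<open>p^n\<close>, the factor survives
      reduction modulo \<open>X^N + 1\<close>.\<close>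
    moreover have "[:-inverse w, 1:] ^ ?k dvd xN1 N"
      unfolding xN1_N using inverse_root[OF w] by (subst linear_power_dvd_prod_iff) auto
    ultimately have "[:-inverse w, 1:] ^ ?k dvd d" unfolding d_def by (rule dvd_mod)
    then have "[:-w, 1:] ^ ?k dvd rev_poly N d"
      using d_reps root_nonzero[OF w] by (intro linear_power_dvd_rev_polyI) (auto simp: reps_def)
    then have "[:-w, 1:] ^ (order w h + ?k) dvd h * rev_poly N d"
      unfolding power_add by (intro mult_dvd_mono order_1)
    moreover have "[:-w, 1:] ^ (p ^ n) dvd [:-w, 1:] ^ (order w h + ?k)"
      by (intro le_imp_power_dvd) simp
    ultimately show "[:-w, 1:] ^ (p ^ n) dvd h * rev_poly N d" by (rule dvd_trans[rotated])
  qed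
  ultimately have "d = 0" using lcd d_reps LCD_gen_code_iff[OF h(1,3)] by blast
  then have "xN1 N dvd G" by (simp add: d_def mod_eq_0_iff_dvd)
  then have "[:-w, 1:] ^ (p ^ n) dvd G" using w by (rule xN1_dvdD)
  then show ?thesis unfolding G_def using w by (simp add: linear_power_dvd_prod_iff b_def)
qed

lemma LCD_imp_stable:
  assumes h: "over_Fq q h" "lead_coeff h = 1" "h dvd xN1 N"
    and lcd: "LCD q N (gen_code q N h)"
  shows "\<exists>A. stable A \<and> h = root_prod A ^ (p ^ n)"
proof -
  have hnz: "h \<noteq> 0" using h(2) by auto
  have ppos: "p ^ n > 0" using p_pos by simp
  have le: "order w h \<le> p ^ n" if "w \<in> R" for w
  proof -
    have "[:-w, 1:] ^ order w h dvd xN1 N" using order_1 h(3) dvd_trans by blast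
    then show ?thesis unfolding xN1_N using that by (simp add: linear_power_dvd_prod_iff)
  qed
  \<comment> \<open>The bound at \<open>w\<close> says that the order at \<open>w\<close> is
    \<open>p^n\<close> or the order at \<open>1/w\<close> is 0; the bound at \<open>1/w\<close> says
    the same with the roles exchanged. Mixed combinations would force
    \<open>p^n = 0\<close>.\<close>
  have inv: "order w h = 0 \<and> order (inverse w) h = 0 \<or> order w h = p ^ n \<and> order (inverse w) h = p ^ n"
    if "w \<in> R" for w
    using LCD_orders[OF h lcd that] LCD_orders[OF h lcd inverse_root[OF that]]
      le[OF that] le[OF inverse_root[OF that]] ppos
    by (auto simp: max_def split: if_splits)
  define A where "A = {w\<in>R. order w h = p ^ n}"
  have "stable A"
    unfolding stable_def A_def
    using inv ppos by (force simp: power_q_root inverse_root order_root_Frob[OF h(1) hnz])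
  moreover have "h = root_prod A ^ (p ^ n)"
    unfolding root_prod_power
    by (subst divisor_eq_prod_orders[OF h(2,3)], rule prod.mono_neutral_cong_right)
       (use inv in \<open>auto simp: A_def, metis power_0\<close>)
  ultimately show ?thesis by blast
qed

theorem LCD_codes_eq_stable:
  "LCD_negacyclic_codes q N = (\<lambda>A. gen_code q N (root_prod A ^ (p ^ n))) ` {A. stable A}"
proof (intro equalityI subsetI)
  fix C :: "'b poly set" assume "C \<in> LCD_negacyclic_codes q N"
  then have C: "negacyclic_code q N C" "LCD q N C" by (auto simp: LCD_negacyclic_codes_def)
  obtain h where h: "over_Fq q h" "lead_coeff h = 1" "h dvd xN1 N" "C = gen_code q N h"
    using negacyclic_code_principal[OF C(1)] by blast
  then show "C \<in> (\<lambda>A. gen_code q N (root_prod A ^ (p ^ n))) ` {A. stable A}"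
    using LCD_imp_stable[OF h(1-3)] C(2) by blast
next
  fix C assume "C \<in> (\<lambda>A. gen_code q N (root_prod A ^ (p ^ n))) ` {A. stable A}"
  then obtain A where A: "stable A" "C = gen_code q N (root_prod A ^ (p ^ n))" by blast
  then have "A \<subseteq> R" by (simp add: stable_def)
  then show "C \<in> LCD_negacyclic_codes q N"
    unfolding LCD_negacyclic_codes_def A(2)
    using LCD_stable[OF A(1)] over_Fq_root_prod_power[OF A(1)]
    by (simp add: negacyclic_code_gen_code root_prod_power_dvd_xN1)
qed

lemma gen_code_root_prod_mono:
  assumes "stable A" "stable B"
    and "gen_code q N (root_prod A ^ (p ^ n)) \<subseteq> gen_code q N (root_prod B ^ (p ^ n))"
  shows "B \<subseteq> A"
proof
  fix w assume w: "w \<in> B"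
  have AB: "A \<subseteq> R" "B \<subseteq> R" using assms by (auto simp: stable_def)
  let ?hA = "root_prod A ^ (p ^ n)" and ?hB = "root_prod B ^ (p ^ n)"
  have "over_Fq q (1 :: 'b poly)" by (simp add: over_Fq_iff_Frob)
  \<comment> \<open>The generator is reduced first, since for \<open>A = R\<close> it is
    \<open>X^N + 1\<close> itself and not a reduced representative.\<close>
  then have "?hA mod xN1 N \<in> gen_code q N ?hA"
    unfolding gen_code_def by (auto intro!: exI[of _ 1])
  then have "?hA mod xN1 N \<in> gen_code q N ?hB" using assms(3) by blast
  then have "?hB dvd ?hA mod xN1 N"
    by (simp add: gen_code_eq[OF over_Fq_root_prod_power[OF assms(2)] root_prod_power_dvd_xN1[OF AB(2)]])
  then have "?hB dvd ?hA"
    using root_prod_power_dvd_xN1[OF AB(2)] by (simp add: dvd_mod_iff)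
  moreover have "poly ?hB w = 0"
    using w p_pos by (auto simp: root_prod_def poly_power poly_prod power_0_left)
  ultimately have "poly ?hA w = 0" by (metis dvdE poly_mult mult_zero_left)
  then show "w \<in> A" by (auto simp: root_prod_def poly_power poly_prod)
qed

lemma inj_on_gen_code: "inj_on (\<lambda>A. gen_code q N (root_prod A ^ (p ^ n))) {A. stable A}"
proof (intro inj_onI equalityI)
  fix A B assume *: "A \<in> {A. stable A}" "B \<in> {A. stable A}"
    "gen_code q N (root_prod A ^ (p ^ n)) = gen_code q N (root_prod B ^ (p ^ n))"
  then show "A \<subseteq> B" "B \<subseteq> A"
    using gen_code_root_prod_mono[of A B] gen_code_root_prod_mono[of B A] by auto
qed

text \<open>The orbit under the group generated by Frobenius and inversion. The two maps commute,
  and Frobenius is a permutation of a finite set, so natural iterates suffice.\<close>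

definition orbit :: "'b \<Rightarrow> 'b set" where
  "orbit w = range (\<lambda>i. w ^ (q ^ i)) \<union> range (\<lambda>i. inverse w ^ (q ^ i))"

lemma stable_power_q_pow_iff:
  assumes "stable A"
  shows "w ^ (q ^ i) \<in> A \<longleftrightarrow> w \<in> A"
  by (induction i) (simp_all add: stable_power_q_iff[OF assms] power_mult mult.commute[of q])

lemma stable_inverse_iff: "stable A \<Longrightarrow> inverse w \<in> A \<longleftrightarrow> w \<in> A"
  unfolding stable_def by (metis inverse_inverse_eq)

lemma mem_stable_orbit_iff:
  assumes "stable A" "x \<in> orbit w"
  shows "x \<in> A \<longleftrightarrow> w \<in> A"
  using assms(2) unfolding orbit_def
  by (auto simp: stable_power_q_pow_iff[OF assms(1)] stable_inverse_iff[OF assms(1)])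

lemma self_in_orbit: "w \<in> orbit w"
  unfolding orbit_def by (auto intro!: image_eqI[of _ _ 0])

lemma stable_orbit:
  assumes "w \<in> R"
  shows "stable (orbit w)"
proof -
  have "orbit w \<subseteq> R" using mem_stable_orbit_iff[OF stable_R] assms by blast
  moreover have "x ^ q \<in> orbit w" if "x \<in> orbit w" for x
  proof -
    from that obtain i where "x = w ^ (q ^ i) \<or> x = inverse w ^ (q ^ i)"
      by (auto simp: orbit_def)
    then have "x ^ q = w ^ (q ^ Suc i) \<or> x ^ q = inverse w ^ (q ^ Suc i)"
      by (auto simp: power_mult mult.commute[of q])
    then show ?thesis unfolding orbit_def by blast
  qed
  moreover have "inverse x \<in> orbit w" if "x \<in> orbit w" for x
    using that by (auto simp: orbit_def power_inverse)
  ultimately show ?thesis by (auto simp: stable_def)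
qed

section \<open>Codes indexed by a transversal of the orbits\<close>

context
  fixes J :: "'i set" and w :: "'i \<Rightarrow> 'b"
  assumes finite_J: "finite J" and w_R: "\<And>j. j \<in> J \<Longrightarrow> w j \<in> R"
    and unique_orbit: "\<And>x. x \<in> R \<Longrightarrow> \<exists>!j. j \<in> J \<and> x \<in> orbit (w j)"
begin

lemma orbit_disjoint:
  assumes "i \<in> J" "j \<in> J" "i \<noteq> j"
  shows "orbit (w i) \<inter> orbit (w j) = {}"
proof -
  have "orbit (w i) \<subseteq> R" using stable_orbit[OF w_R] assms(1) by (simp add: stable_def)
  then show ?thesis using unique_orbit assms by blast
qed

text \<open>A stable set contains an orbit entirely or not at all, so it is determined by the
  representatives that it contains.\<close>

lemma stable_sets_eq: "{A. stable A} = (\<lambda>S. \<Union>j\<in>S. orbit (w j)) ` Pow J"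
proof (intro equalityI subsetI)
  fix A assume "A \<in> {A. stable A}"
  then have A: "stable A" by simp
  have "A = (\<Union>j\<in>{j\<in>J. w j \<in> A}. orbit (w j))"
  proof (intro equalityI subsetI)
    fix x assume "x \<in> A"
    moreover from this have "x \<in> R" using A by (auto simp: stable_def)
    then obtain j where "j \<in> J" "x \<in> orbit (w j)" using unique_orbit by blast
    ultimately show "x \<in> (\<Union>j\<in>{j\<in>J. w j \<in> A}. orbit (w j))"
      using mem_stable_orbit_iff[OF A] by blast
  qed (use mem_stable_orbit_iff[OF A] in blast)
  then show "A \<in> (\<lambda>S. \<Union>j\<in>S. orbit (w j)) ` Pow J" by blast
next
  fix A assume "A \<in> (\<lambda>S. \<Union>j\<in>S. orbit (w j)) ` Pow J"
  then obtain S where "S \<subseteq> J" "A = (\<Union>j\<in>S. orbit (w j))" by blast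
  then show "A \<in> {A. stable A}"
    using stable_orbit[OF w_R] unfolding stable_def by blast
qed

lemma inj_on_union_orbits: "inj_on (\<lambda>S. \<Union>j\<in>S. orbit (w j)) (Pow J)"
proof (rule inj_on_inverseI[where g = "\<lambda>A. {j\<in>J. w j \<in> A}"])
  fix S assume S: "S \<in> Pow J"
  show "{j\<in>J. w j \<in> (\<Union>j\<in>S. orbit (w j))} = S"
    using S self_in_orbit orbit_disjoint by blast
qed

text \<open>Exponents restricted to 0 and \<open>p^n\<close> only select a subset of the pairwise
  disjoint orbits.\<close>

lemma prod_orbit_powers:
  assumes "\<And>j. j \<in> J \<Longrightarrow> \<epsilon> j \<in> {0, p ^ n}"
  shows "(\<Prod>j\<in>J. root_prod (orbit (w j)) ^ \<epsilon> j)
    = root_prod (\<Union>j\<in>{j\<in>J. \<epsilon> j \<noteq> 0}. orbit (w j)) ^ (p ^ n)"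
proof -
  let ?S = "{j\<in>J. \<epsilon> j \<noteq> 0}"
  have "(\<Prod>j\<in>J. root_prod (orbit (w j)) ^ \<epsilon> j) = (\<Prod>j\<in>?S. root_prod (orbit (w j)) ^ (p ^ n))"
    using finite_J by (intro prod.mono_neutral_cong_right) (auto dest: assms)
  also have "root_prod (\<Union>j\<in>?S. orbit (w j)) = (\<Prod>j\<in>?S. root_prod (orbit (w j)))"
    unfolding root_prod_def using finite_J orbit_disjoint by (intro prod.UNION_disjoint) auto
  ultimately show ?thesis by (simp add: prod_power_distrib)
qed

theorem LCD_codes_orbits:
  "LCD_negacyclic_codes q N = {gen_code q N (\<Prod>j\<in>J. root_prod (orbit (w j)) ^ \<epsilon> j)
      | \<epsilon>. \<forall>j\<in>J. \<epsilon> j \<in> {0, p ^ n}}"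
proof (intro equalityI subsetI)
  fix C :: "'b poly set" assume "C \<in> LCD_negacyclic_codes q N"
  then obtain S where S: "S \<subseteq> J" "C = gen_code q N (root_prod (\<Union>j\<in>S. orbit (w j)) ^ (p ^ n))"
    unfolding LCD_codes_eq_stable stable_sets_eq by blast
  define \<epsilon> where "\<epsilon> = (\<lambda>j. if j \<in> S then p ^ n else 0)"
  have "{j\<in>J. \<epsilon> j \<noteq> 0} = S" using S(1) p_pos by (auto simp: \<epsilon>_def)
  then have "C = gen_code q N (\<Prod>j\<in>J. root_prod (orbit (w j)) ^ \<epsilon> j)"
    using S(2) by (subst prod_orbit_powers) (auto simp: \<epsilon>_def)
  then show "C \<in> {gen_code q N (\<Prod>j\<in>J. root_prod (orbit (w j)) ^ \<epsilon> j)
      | \<epsilon>. \<forall>j\<in>J. \<epsilon> j \<in> {0, p ^ n}}"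
    by (auto simp: \<epsilon>_def intro!: exI[of _ \<epsilon>])
next
  fix C assume "C \<in> {gen_code q N (\<Prod>j\<in>J. root_prod (orbit (w j)) ^ \<epsilon> j)
      | \<epsilon>. \<forall>j\<in>J. \<epsilon> j \<in> {0, p ^ n}}"
  then obtain \<epsilon> where \<epsilon>: "\<And>j. j \<in> J \<Longrightarrow> \<epsilon> j \<in> {0, p ^ n}"
    "C = gen_code q N (\<Prod>j\<in>J. root_prod (orbit (w j)) ^ \<epsilon> j)" by blast
  show "C \<in> LCD_negacyclic_codes q N"
    unfolding LCD_codes_eq_stable stable_sets_eq \<epsilon>(2) by (subst prod_orbit_powers) (use \<epsilon>(1) in blast)+
qed

theorem card_LCD_codes_orbits:
  "card (LCD_negacyclic_codes q N :: 'b poly set set) = 2 ^ card J"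
proof -
  have "card (LCD_negacyclic_codes q N :: 'b poly set set) = card {A. stable A}"
    unfolding LCD_codes_eq_stable by (rule card_image[OF inj_on_gen_code])
  also have "\<dots> = card (Pow J)"
    unfolding stable_sets_eq by (rule card_image[OF inj_on_union_orbits])
  finally show ?thesis using finite_J by (simp add: card_Pow)
qed

end

text \<open>A form of the classification with one orbit listed apart, prepared for the factor
  \<open>X^2 + 1\<close>. In the index type \<open>option\<close>, \<open>None\<close> stands for
  that orbit.\<close>

lemma LCD_codes_orbits_insert:
  fixes I :: "'i set" and w :: "'i \<Rightarrow> 'b"
  assumes fin: "finite I" and w0: "w0 \<in> R" and wR: "\<And>i. i \<in> I \<Longrightarrow> w i \<in> R"
    and disj: "\<And>i x. i \<in> I \<Longrightarrow> x \<in> orbit w0 \<Longrightarrow> x \<notin> orbit (w i)"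
    and unique: "\<And>x. x \<in> R \<Longrightarrow> x \<notin> orbit w0 \<Longrightarrow> \<exists>!i. i \<in> I \<and> x \<in> orbit (w i)"
  shows "LCD_negacyclic_codes q N =
      {gen_code q N (root_prod (orbit w0) ^ \<epsilon>0 * (\<Prod>i\<in>I. root_prod (orbit (w i)) ^ \<epsilon> i))
        | \<epsilon>0 \<epsilon>. \<epsilon>0 \<in> {0, p ^ n} \<and> (\<forall>i\<in>I. \<epsilon> i \<in> {0, p ^ n})}" (is "_ = ?rhs")
    and "card (LCD_negacyclic_codes q N :: 'b poly set set) = 2 ^ (1 + card I)"
proof -
  define J where "J = insert None (Some ` I)"
  define v where "v = case_option w0 w"
  have J: "finite J" "\<And>j. j \<in> J \<Longrightarrow> v j \<in> R"
    using fin w0 wR by (auto simp: J_def v_def split: option.split)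
  have J_unique: "\<exists>!j. j \<in> J \<and> x \<in> orbit (v j)" if "x \<in> R" for x
  proof (cases "x \<in> orbit w0")
    case True
    then show ?thesis using disj by (intro ex1I[of _ None]) (auto simp: J_def v_def)
  next
    case False
    then obtain i where i: "i \<in> I" "x \<in> orbit (w i)"
      using unique[OF \<open>x \<in> R\<close>] by blast
    show ?thesis
    proof (rule ex1I[of _ "Some i"])
      fix j assume j: "j \<in> J \<and> x \<in> orbit (v j)"
      then obtain i' where "j = Some i'" "i' \<in> I" "x \<in> orbit (w i')"
        using False by (auto simp: J_def v_def)
      then show "j = Some i" using i unique[OF \<open>x \<in> R\<close> False] by blast
    qed (use i in \<open>simp add: J_def v_def\<close>)
  qed
  have prod_J: "(\<Prod>j\<in>J. root_prod (orbit (v j)) ^ \<epsilon> j)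
      = root_prod (orbit w0) ^ \<epsilon> None * (\<Prod>i\<in>I. root_prod (orbit (w i)) ^ \<epsilon> (Some i))" for \<epsilon>
    unfolding J_def using fin by (simp add: prod.reindex v_def)
  show "LCD_negacyclic_codes q N = ?rhs"
    unfolding LCD_codes_orbits[OF J J_unique, simplified] prod_J
  proof (intro equalityI subsetI)
    fix C assume "C \<in> ?rhs"
    then obtain \<epsilon>0 \<epsilon> where *: "\<epsilon>0 \<in> {0, p ^ n}" "\<forall>i\<in>I. \<epsilon> i \<in> {0, p ^ n}"
      "C = gen_code q N (root_prod (orbit w0) ^ \<epsilon>0 * (\<Prod>i\<in>I. root_prod (orbit (w i)) ^ \<epsilon> i))"
      by blast
    then show "C \<in> {gen_code q N (root_prod (orbit w0) ^ \<epsilon> None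
        * (\<Prod>i\<in>I. root_prod (orbit (w i)) ^ \<epsilon> (Some i))) |\<epsilon>. \<forall>j\<in>J. \<epsilon> j = 0 \<or> \<epsilon> j = p ^ n}"
      by (auto simp: J_def intro!: exI[of _ "case_option \<epsilon>0 \<epsilon>"])
  qed (fastforce simp: J_def)
  have "card J = 1 + card I"
    unfolding J_def using fin by (simp add: card_image)
  then show "card (LCD_negacyclic_codes q N :: 'b poly set set) = 2 ^ (1 + card I)"
    using card_LCD_codes_orbits[OF J J_unique] by simp
qed

end

section \<open>Powers of q modulo l^m\<close>

text \<open>In \<open>x^l - 1 = (x - 1) (1 + x + ... + x^(l-1))\<close> the second factor is a sum
  of \<open>l\<close> terms congruent to 1 modulo \<open>l\<close>, which supplies one more factor
  \<open>l\<close>.\<close>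

lemma cong_1_power_prime_step:
  fixes x :: int and l r :: nat
  assumes "[x = 1] (mod int l ^ r)" "r \<ge> 1"
  shows "[x ^ l = 1] (mod int l ^ Suc r)"
proof -
  have "[x = 1] (mod int l)"
    using assms by (metis One_nat_def Suc_le_D cong_dvd_modulus dvd_triv_left power_Suc)
  then have "[(\<Sum>i<l. x ^ i) = (\<Sum>i<l. 1 ^ i)] (mod int l)"
    by (intro cong_sum cong_pow)
  then have "int l dvd (\<Sum>i<l. x ^ i)"
    by (simp add: cong_dvd_iff)
  moreover have "int l ^ r dvd x - 1" using assms(1) by (simp add: cong_iff_dvd_diff)
  ultimately have "int l ^ r * int l dvd (x - 1) * (\<Sum>i<l. x ^ i)" by (intro mult_dvd_mono)
  also have "(x - 1) * (\<Sum>i<l. x ^ i) = x ^ l - 1" by (simp add: power_diff_1_eq)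
  finally show ?thesis by (simp add: cong_iff_dvd_diff mult.commute)
qed

lemma cong_1_power_prime_power:
  fixes x :: int and l r :: nat
  assumes "[x = 1] (mod int l ^ r)" "r \<ge> 1"
  shows "[x ^ (l ^ j) = 1] (mod int l ^ (r + j))"
proof (induction j)
  case (Suc j)
  from cong_1_power_prime_step[OF this] assms(2) show ?case
    by (simp add: power_mult mult.commute[of l])
qed (use assms in simp)

locale odd_prime_power_modulus =
  fixes l m q :: nat
  assumes prime_l: "prime l" and odd_l: "odd l" and m_pos: "m > 0" and coprime_q: "coprime l q"
begin

abbreviation "f \<equiv> ord l q"

lemma l_gt_2: "l > 2"
  using prime_l odd_l prime_gt_1_nat[of l] by (cases "l = 2") auto

lemma prime_int_l: "prime (int l)"
  using prime_l by simp

lemma not_dvd_q_power: "\<not> int l dvd int q ^ i"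
  using coprime_q prime_l prime_int_l
  by (metis coprime_absorb_left int_dvd_int_iff not_prime_unit prime_dvd_power)

lemma f_pos: "f > 0"
  using coprime_q by simp

lemma q_power_cong_iff: "[int q ^ i = int q ^ j] (mod int l) \<longleftrightarrow> [i = j] (mod f)"
  using order_divides_expdiff[OF coprime_q, of i j]
  by (simp flip: cong_int_iff of_nat_power)

lemma q_power_f: "[int q ^ f = 1] (mod int l)"
  using q_power_cong_iff[of f 0] by (simp add: cong_0_iff)

text \<open>A period that may be larger than the order of \<open>q\<close>, but explicit. Since
  \<open>l\<close> is odd, its parity is that of \<open>f\<close>.\<close>

lemma q_power_period: "[int q ^ (f * l ^ (m - 1)) = 1] (mod int l ^ m)"
  using cong_1_power_prime_power[of "int q ^ f" l 1 "m - 1"] q_power_f m_pos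
  by (simp add: power_mult)

text \<open>The square of \<open>q^(f/2)\<close> is 1 modulo the prime \<open>l\<close>, and
  minimality of \<open>f\<close> rules out the value 1, so the value is -1. Raising to the odd power
  \<open>l^(m-1)\<close> lifts this to modulus \<open>l^m\<close> and keeps the sign.\<close>

lemma q_power_minus_1:
  assumes "even f"
  shows "[int q ^ (f div 2 * l ^ (m - 1)) = -1] (mod int l ^ m)"
proof -
  define y where "y = int q ^ (f div 2)"
  have "y * y = int q ^ f" unfolding y_def power_add[symmetric] using assms by (auto simp: mult_2 elim!: evenE)
  then have "int l dvd y * y - 1" using q_power_f by (simp add: cong_iff_dvd_diff)
  then have "int l dvd (y - 1) * (y + 1)" by (simp add: algebra_simps)
  then have "int l dvd y - 1 \<or> int l dvd y + 1" using prime_int_l by (simp add: prime_dvd_mult_iff)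
  moreover have "\<not> int l dvd y - 1"
  proof
    assume "int l dvd y - 1"
    then have "[int q ^ (f div 2) = int q ^ 0] (mod int l)" by (simp add: y_def cong_iff_dvd_diff)
    then have "f dvd f div 2" unfolding q_power_cong_iff by (simp add: cong_0_iff)
    moreover obtain b where "f = 2 * b" using assms by (rule evenE)
    then have "0 < f div 2 \<and> f div 2 < f" using f_pos by (auto simp del: ord_gt_0_iff)
    ultimately show False by (meson nat_dvd_not_less)
  qed
  ultimately have "[- y = 1] (mod int l ^ 1)"
    by (simp add: cong_iff_dvd_diff) (metis add.commute dvd_minus_iff minus_add_distrib uminus_add_conv_diff)
  from cong_1_power_prime_power[OF this, of "m - 1"] have "[- (y ^ (l ^ (m - 1))) = 1] (mod int l ^ m)"
    using m_pos odd_l by simp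
  then have "[- (- (y ^ (l ^ (m - 1)))) = -1] (mod int l ^ m)" by (subst cong_minus_minus_iff)
  then show ?thesis by (simp add: y_def power_mult)
qed

text \<open>Since \<open>u\<close> may carry up to \<open>m - 1\<close> factors \<open>l\<close>,
  only one is guaranteed for \<open>x\<close>. This is why powers of \<open>q\<close> are compared
  modulo \<open>l\<close>, and why \<open>f\<close> governs the cases for every nonzero
  exponent.\<close>

lemma dvd_cofactor:
  assumes "int l ^ m dvd u * x" "\<not> int l ^ m dvd u"
  shows "int l dvd x"
proof (rule ccontr)
  assume "\<not> int l dvd x"
  then have "coprime (int l ^ m) x"
    using prime_int_l by (simp add: prime_imp_coprime)
  then show False using assms by (simp add: coprime_dvd_mult_left_iff)
qed

text \<open>The congruence descends to \<open>q^i = q^j\<close> modulo \<open>l\<close>, hence to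
  \<open>i = j\<close> modulo the even number \<open>f\<close>.\<close>

lemma same_parity:
  assumes "even f" "\<not> int l ^ m dvd u" "[u * int q ^ i = u * int q ^ j] (mod int l ^ m)"
  shows "even i \<longleftrightarrow> even j"
proof -
  have "int l ^ m dvd u * (int q ^ i - int q ^ j)"
    using assms(3) by (simp add: cong_iff_dvd_diff algebra_simps)
  then have "[int q ^ i = int q ^ j] (mod int l)"
    using assms(2) dvd_cofactor by (simp add: cong_iff_dvd_diff)
  then have "[i = j] (mod 2)"
    unfolding q_power_cong_iff using assms(1) cong_dvd_modulus_nat by blast
  then show ?thesis by (metis cong_def even_iff_mod_2_eq_zero)
qed

text \<open>Modulo \<open>l\<close> one would have \<open>q^i = -q^j\<close>. Squaring and
  cancelling 2 modulo the odd number \<open>f\<close> gives \<open>q^i = q^j\<close>, so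
  \<open>l\<close> would divide \<open>2 q^i\<close>.\<close>

lemma not_cong_minus:
  assumes "odd f" "\<not> int l ^ m dvd u"
  shows "\<not> [u * int q ^ i = - u * int q ^ j] (mod int l ^ m)"
proof
  assume "[u * int q ^ i = - u * int q ^ j] (mod int l ^ m)"
  then have "int l ^ m dvd u * (int q ^ i + int q ^ j)"
    by (simp add: cong_iff_dvd_diff algebra_simps)
  then have d: "int l dvd int q ^ i + int q ^ j" using assms(2) dvd_cofactor by blast
  then have "int l dvd (int q ^ i + int q ^ j) * (int q ^ i - int q ^ j)" by simp
  then have "[int q ^ (i + i) = int q ^ (j + j)] (mod int l)"
    by (simp add: cong_iff_dvd_diff power_add algebra_simps)
  then have "[2 * i = 2 * j] (mod f)" unfolding q_power_cong_iff by (simp add: mult_2)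
  then have "[i = j] (mod f)" using assms(1) by (simp add: cong_mult_lcancel_nat)
  then have "int l dvd int q ^ i - int q ^ j"
    using q_power_cong_iff by (simp add: cong_iff_dvd_diff)
  with d have "int l dvd (int q ^ i + int q ^ j) + (int q ^ i - int q ^ j)" by (rule dvd_add)
  then have "int l dvd 2 * int q ^ i" by simp
  then have "int l dvd 2" using prime_int_l not_dvd_q_power by (simp add: prime_dvd_mult_iff)
  then show False using l_gt_2 by (auto dest: zdvd_imp_le)
qed

text \<open>Below \<open>m\<close>, the exact power of \<open>l\<close> in a number is visible
  modulo \<open>l^m\<close>; cancelling it lowers the modulus accordingly.\<close>

lemma valuation_cong:
  assumes "c < m" "c' < m" "\<not> int l dvd a" "\<not> int l dvd a'"
    and "[int l ^ c * a = int l ^ c' * a'] (mod int l ^ m)"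
  shows "c = c'" "[a = a'] (mod int l ^ (m - c))"
proof -
  have aux: "\<not> c < c'" if "[int l ^ c * a = int l ^ c' * a'] (mod int l ^ m)"
    "c < m" "\<not> int l dvd a" for c c' a a'
  proof
    assume "c < c'"
    have "int l ^ Suc c dvd int l ^ m" "int l ^ Suc c dvd int l ^ c' * a'"
      using that(2) \<open>c < c'\<close> by (auto simp: le_imp_power_dvd simp del: power_Suc intro: dvd_mult2)
    then have "int l ^ Suc c dvd int l ^ c * a"
      using that(1) by (meson cong_dvd_iff cong_dvd_modulus)
    then show False using that(3) prime_int_l by (simp add: mult.commute[of "int l"])
  qed
  show c: "c = c'"
    using aux[OF assms(5,1,3)] aux[OF cong_sym[OF assms(5)] assms(2,4)] by simp
  have "int l ^ m = int l ^ c * int l ^ (m - c)" using assms(1) by (simp flip: power_add)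
  then have "int l ^ c * int l ^ (m - c) dvd int l ^ c * (a - a')"
    using assms(5) c by (simp add: cong_iff_dvd_diff right_diff_distrib)
  then show "[a = a'] (mod int l ^ (m - c))"
    using prime_l by (simp add: cong_iff_dvd_diff prime_gt_0_nat)
qed

end

section \<open>A transversal up to sign built from a primitive root\<close>

locale odd_order_primroot = odd_prime_power_modulus +
  fixes g :: nat
  assumes odd_f: "odd (ord l q)" and primroot: "residue_primroot (l ^ m) g"
begin

lemma coprime_g: "coprime l g"
  using primroot m_pos by (auto simp: residue_primroot_def coprime_commute)

lemma not_dvd_g_power: "\<not> int l dvd int g ^ i"
  using coprime_g prime_l prime_int_l
  by (metis coprime_absorb_left int_dvd_int_iff not_prime_unit prime_dvd_power)

abbreviation "\<delta> r \<equiv> totient (l ^ r) div ord (l ^ r) q"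

text \<open>A relation \<open>g^o = 1\<close> modulo \<open>l^r\<close> lifts to
  \<open>g^(o l^(m-r)) = 1\<close> modulo \<open>l^m\<close>. There the order is
  \<open>totient (l^r) * l^(m-r)\<close>, and the common factor cancels.\<close>

lemma ord_g:
  assumes "1 \<le> r" "r \<le> m"
  shows "ord (l ^ r) g = totient (l ^ r)"
proof (rule dvd_antisym)
  show "ord (l ^ r) g dvd totient (l ^ r)"
    using coprime_g by (intro order_divides_totient) simp
  let ?o = "ord (l ^ r) g"
  have "[int g ^ ?o = 1] (mod int l ^ r)"
    using ord[of g "l ^ r"] by (metis cong_int_iff of_nat_power of_nat_1)
  from cong_1_power_prime_power[OF this assms(1), of "m - r"]
  have "[int (g ^ (?o * l ^ (m - r))) = int 1] (mod int (l ^ m))"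
    using assms by (simp add: power_mult)
  then have "ord (l ^ m) g dvd ?o * l ^ (m - r)"
    unfolding cong_int_iff by (simp add: ord_divides')
  moreover have "ord (l ^ m) g = totient (l ^ m)"
    using primroot by (simp add: residue_primroot_def)
  moreover have "totient (l ^ m) = totient (l ^ r) * l ^ (m - r)"
    using assms m_pos prime_l by (simp add: totient_prime_power flip: power_add)
  ultimately show "totient (l ^ r) dvd ?o"
    using prime_l by (simp add: prime_gt_0_nat)
qed

lemma ord_q_odd:
  assumes "1 \<le> r"
  shows "odd (ord (l ^ r) q)"
proof -
  have "[int (q ^ (f * l ^ (r - 1))) = int 1] (mod int (l ^ r))"
    using cong_1_power_prime_power[of "int q ^ f" l 1 "r - 1"] q_power_f assms
    by (simp add: power_mult)
  then have "ord (l ^ r) q dvd f * l ^ (r - 1)"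
    unfolding cong_int_iff by (simp add: ord_divides')
  moreover have "odd (f * l ^ (r - 1))" using odd_f odd_l by simp
  ultimately show ?thesis by (meson dvd_trans)
qed

lemma delta_mult_ord: "\<delta> r * ord (l ^ r) q = totient (l ^ r)"
  using coprime_q by (intro dvd_div_mult_self order_divides_totient) simp

text \<open>The totient is even and the order of \<open>q\<close> is odd. Hence
  \<open>\<delta> r div 2\<close> is an exact half.\<close>

lemma even_delta:
  assumes "1 \<le> r"
  shows "even (\<delta> r)"
proof -
  have "even (totient (l ^ r))"
    using assms prime_l odd_l by (simp add: totient_prime_power)
  then show ?thesis
    using delta_mult_ord[of r] ord_q_odd[OF assms] by (metis even_mult_iff)
qed

text \<open>Squaring removes the sign \<open>c\<close>, and raising to the order of \<open>q\<close>
  removes the powers of \<open>q\<close>. What remains are powers of \<open>g\<close> with exponents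
  \<open>2 k ord(q)\<close> and \<open>2 k' ord(q)\<close>, both below the order of \<open>g\<close>
  exactly because \<open>k\<close> and \<open>k'\<close> stay below
  \<open>\<delta> r / 2\<close>.\<close>

lemma half_transversal_unique:
  assumes r: "1 \<le> r" "r \<le> m" and k: "k < \<delta> r div 2" "k' < \<delta> r div 2"
    and cong: "[int g ^ k * int q ^ i = c * (int g ^ k' * int q ^ i')] (mod int l ^ r)"
    and c: "c * c = 1"
  shows "k = k'"
proof -
  let ?L = "ord (l ^ r) q"
  let ?x = "int g ^ k * int q ^ i" and ?y = "int g ^ k' * int q ^ i'"
  have pow: "[(int q ^ j) ^ ?L = 1] (mod int l ^ r)" for j
  proof -
    have "[q ^ (j * ?L) = 1] (mod l ^ r)" by (simp add: ord_divides')
    then have "[int (q ^ (j * ?L)) = int 1] (mod int (l ^ r))" unfolding cong_int_iff .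
    then show ?thesis by (simp add: power_mult)
  qed
  have "[?x * ?x = (c * ?y) * (c * ?y)] (mod int l ^ r)" using cong cong by (rule cong_mult)
  moreover have "(c * ?y) * (c * ?y) = (c * c) * (?y * ?y)" by (simp only: mult_ac)
  ultimately have sq: "[?x * ?x = ?y * ?y] (mod int l ^ r)" by (simp add: c)
  have raise: "[(int g ^ k * int q ^ i * (int g ^ k * int q ^ i)) ^ ?L = int g ^ (2 * k * ?L)] (mod int l ^ r)"
    for k i
  proof -
    have "int g ^ k * int q ^ i * (int g ^ k * int q ^ i) = int g ^ (2 * k) * int q ^ (2 * i)"
      by (simp only: mult_2 power_add) (simp only: mult_ac)
    then have "(int g ^ k * int q ^ i * (int g ^ k * int q ^ i)) ^ ?L
        = int g ^ (2 * k * ?L) * (int q ^ (2 * i)) ^ ?L"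
      by (simp only: power_mult_distrib power_mult)
    then show ?thesis using cong_scalar_left[OF pow[of "2 * i"], of "int g ^ (2 * k * ?L)"] by simp
  qed
  have "[int g ^ (2 * k * ?L) = int g ^ (2 * k' * ?L)] (mod int l ^ r)"
    using cong_trans[OF cong_trans[OF cong_sym[OF raise] cong_pow[OF sq]] raise] .
  then have "[int (g ^ (2 * k * ?L)) = int (g ^ (2 * k' * ?L))] (mod int (l ^ r))" by simp
  then have "[2 * k * ?L = 2 * k' * ?L] (mod totient (l ^ r))"
    unfolding cong_int_iff using coprime_g order_divides_expdiff[of "l ^ r" g] ord_g[OF r] by simp
  moreover have lam: "?L > 0" using coprime_q by simp
  moreover have "2 * k * ?L < \<delta> r * ?L" "2 * k' * ?L < \<delta> r * ?L"
    using k lam by (intro mult_strict_right_mono; linarith)+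
  then have "2 * k * ?L < totient (l ^ r)" "2 * k' * ?L < totient (l ^ r)"
    by (simp_all only: delta_mult_ord)
  ultimately have "2 * k * ?L = 2 * k' * ?L" using cong_less_modulus_unique_nat by blast
  then show ?thesis using lam by simp
qed

text \<open>The elements \<open>\<plusminus>g^k q^i\<close> with \<open>k < \<delta> r / 2\<close> and \<open>i < ord q\<close> are pairwise
  incongruent units, and there are as many of them as there are units.\<close>

lemma half_transversal_exists:
  assumes r: "1 \<le> r" "r \<le> m" and v: "\<not> int l dvd v"
  shows "\<exists>k < \<delta> r div 2. \<exists>i. [v = int g ^ k * int q ^ i] (mod int l ^ r)
    \<or> [v = - (int g ^ k * int q ^ i)] (mod int l ^ r)"
proof -
  let ?L = "ord (l ^ r) q"
  define D where "D = {1, -1::int} \<times> {0..<\<delta> r div 2} \<times> {0..<?L}"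
  define h where "h = (\<lambda>(b, k, i). nat ((b * (int g ^ k * int q ^ i)) mod int l ^ r))"
  have lr: "int l ^ r > 0" using prime_l by (simp add: prime_gt_0_nat)
  have h_eq: "[b * (int g ^ k * int q ^ i) = b' * (int g ^ k' * int q ^ i')] (mod int l ^ r)"
    if "h (b, k, i) = h (b', k', i')" for b k i b' k' i'
    using that by (simp add: h_def cong_def eq_nat_nat_iff[OF pos_mod_sign[OF lr] pos_mod_sign[OF lr]])
  have "inj_on h D"
  proof (rule inj_onI)
    fix x y assume xy: "x \<in> D" "y \<in> D" "h x = h y"
    obtain b k i b' k' i' where x: "x = (b, k, i)" and y: "y = (b', k', i')" by (metis prod_cases3)
    have b: "b * b = 1" "b' * b' = 1" "b \<in> {1, -1}" "b' \<in> {1, -1}"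
      and k: "k < \<delta> r div 2" "k' < \<delta> r div 2" and i: "i < ?L" "i' < ?L"
      using xy by (auto simp: x y D_def)
    note c = h_eq[OF xy(3)[unfolded x y]]
    have c1: "[int g ^ k * int q ^ i = (b * b') * (int g ^ k' * int q ^ i')] (mod int l ^ r)"
      using cong_scalar_left[OF c, of b] b by (simp add: mult.assoc[symmetric])
    have kk: "k = k'"
      by (rule half_transversal_unique[OF r k c1]) (use b in auto)
    have "int l ^ r dvd int g ^ k * (int q ^ i - (b * b') * int q ^ i')"
      using c1 kk by (simp add: cong_iff_dvd_diff algebra_simps)
    moreover have "coprime (int l ^ r) (int g ^ k)"
      using not_dvd_g_power prime_int_l by (intro coprime_power_left_iff[THEN iffD2] disjI1 prime_imp_coprime)
    ultimately have c2: "[int q ^ i = (b * b') * int q ^ i'] (mod int l ^ r)"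
      by (simp add: cong_iff_dvd_diff coprime_dvd_mult_right_iff)
    \<comment> \<open>Opposite signs would make a power of \<open>q\<close> congruent to minus
      another one modulo \<open>l\<close>, which odd \<open>f\<close> forbids.\<close>
    have bb: "b * b' = 1"
    proof (rule ccontr)
      assume "b * b' \<noteq> 1"
      then have "b * b' = -1" using b by auto
      then have "[1 * int q ^ i = - 1 * int q ^ i'] (mod int l ^ r)" using c2 by simp
      then have "[1 * int q ^ i = - 1 * int q ^ i'] (mod int l ^ 1)"
        using r by (rule_tac cong_dvd_modulus[of _ _ "int l ^ r"]) (auto simp: le_imp_power_dvd)
      moreover interpret one: odd_prime_power_modulus l 1 q
        by unfold_locales (use prime_l odd_l coprime_q in auto)
      have "\<not> int l ^ 1 dvd 1" using l_gt_2 by auto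
      ultimately show False using one.not_cong_minus odd_f by blast
    qed
    then have "[int (q ^ i) = int (q ^ i')] (mod int (l ^ r))" using c2 by simp
    then have "[i = i'] (mod ?L)"
      unfolding cong_int_iff using order_divides_expdiff[of "l ^ r" q] coprime_q by simp
    then have "i = i'" using i by (simp add: cong_less_modulus_unique_nat)
    moreover have "b = b'" using bb b by auto
    ultimately show "x = y" using x y kk by simp
  qed
  then have "card (h ` D) = card D" by (rule card_image)
  also have "card D = (2 * (\<delta> r div 2)) * ?L"
    unfolding D_def by (simp add: card_cartesian_product)
  also have "\<dots> = totient (l ^ r)"
    using even_delta[OF r(1)] delta_mult_ord[of r] by simp
  finally have card: "card (h ` D) = card (totatives (l ^ r))" by (simp add: totient_def)
  have lr1: "l ^ r > 1" using r l_gt_2 by (intro one_less_power) auto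
  have unit: "nat (z mod int l ^ r) \<in> totatives (l ^ r)" if "\<not> int l dvd z" for z
  proof -
    have "coprime (int l ^ r) z" using that prime_int_l by (simp add: prime_imp_coprime)
    then have "coprime (z mod int l ^ r) (int l ^ r)"
      using lr by (subst coprime_mod_left_iff) (auto simp: coprime_commute)
    moreover have z0: "0 \<le> z mod int l ^ r" "z mod int l ^ r < int l ^ r" using lr by auto
    ultimately have cop: "coprime (nat (z mod int l ^ r)) (l ^ r)"
      by (simp flip: coprime_int_iff)
    then have "nat (z mod int l ^ r) \<noteq> 0" using lr1 by (metis coprime_0_left_iff nat_dvd_1_iff_1 less_irrefl)
    moreover have "nat (z mod int l ^ r) \<le> l ^ r" using z0 by (simp add: nat_le_iff)
    ultimately show ?thesis using cop by (simp add: totatives_def)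
  qed
  have "h ` D \<subseteq> totatives (l ^ r)"
  proof clarify
    fix b k i assume "(b, k, i) \<in> D"
    then have "\<not> int l dvd b * (int g ^ k * int q ^ i)"
      using prime_int_l not_dvd_g_power not_dvd_q_power by (auto simp: D_def prime_dvd_mult_iff)
    then show "h (b, k, i) \<in> totatives (l ^ r)" unfolding h_def using unit by simp
  qed
  with card have "h ` D = totatives (l ^ r)" by (intro card_subset_eq) auto
  then have "nat (v mod int l ^ r) \<in> h ` D" using unit[OF v] by simp
  then obtain b k i where D: "(b, k, i) \<in> D" and "nat (v mod int l ^ r) = h (b, k, i)" by auto
  then have "[v = b * (int g ^ k * int q ^ i)] (mod int l ^ r)"
    by (simp add: h_def cong_def eq_nat_nat_iff[OF pos_mod_sign[OF lr] pos_mod_sign[OF lr]])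
  moreover have "k < \<delta> r div 2" "b = 1 \<or> b = -1" using D by (auto simp: D_def)
  ultimately show ?thesis by (metis mult_1 mult_minus1)
qed

text \<open>Split off the exact power \<open>l^c\<close> of \<open>s\<close>, where
  \<open>c < m\<close>. With \<open>r = m - c\<close> the cofactor is a unit modulo
  \<open>l^r\<close>, so the unit case applies.\<close>

lemma transversal_exists:
  assumes "\<not> int l ^ m dvd s"
  shows "\<exists>r\<in>{1..m}. \<exists>k\<in>{0..<\<delta> r div 2}. \<exists>i. [s = int (l ^ (m - r) * g ^ k) * int q ^ i] (mod int l ^ m)
    \<or> [s = - int (l ^ (m - r) * g ^ k) * int q ^ i] (mod int l ^ m)"
proof -
  have s0: "s \<noteq> 0" using assms by auto
  define c where "c = multiplicity (int l) s"
  obtain v where v: "s = int l ^ c * v" "\<not> int l dvd v"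
    using multiplicity_decompose'[of s "int l"] s0 prime_int_l unfolding c_def
    by (metis not_prime_unit)
  have c: "c < m"
    using assms v(1) by (metis dvd_mult2 le_imp_power_dvd not_le)
  define r where "r = m - c"
  have r: "1 \<le> r" "r \<le> m" "m - r = c" using c by (auto simp: r_def)
  have lm: "int l ^ m = int l ^ c * int l ^ r" using c by (simp add: r_def flip: power_add)
  obtain k i where k: "k < \<delta> r div 2" and "[v = int g ^ k * int q ^ i] (mod int l ^ r)
    \<or> [v = - (int g ^ k * int q ^ i)] (mod int l ^ r)"
    using half_transversal_exists[OF r(1,2) v(2)] by blast
  then have "[int l ^ c * v = int l ^ c * (int g ^ k * int q ^ i)] (mod int l ^ c * int l ^ r)
    \<or> [int l ^ c * v = int l ^ c * - (int g ^ k * int q ^ i)] (mod int l ^ c * int l ^ r)"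
    by (metis cong_cmult_leftI)
  then have "[s = int (l ^ (m - r) * g ^ k) * int q ^ i] (mod int l ^ m)
    \<or> [s = - int (l ^ (m - r) * g ^ k) * int q ^ i] (mod int l ^ m)"
    unfolding lm r v(1) by (simp add: mult.assoc)
  then show ?thesis using k r by (intro bexI[of _ r] bexI[of _ k] exI[of _ i]) auto
qed

text \<open>The power of \<open>l\<close> recovers \<open>r\<close>; the remaining congruence of
  units modulo \<open>l^r\<close> recovers \<open>k\<close>.\<close>

lemma transversal_unique:
  assumes "r \<in> {1..m}" "r' \<in> {1..m}" "k \<in> {0..<\<delta> r div 2}" "k' \<in> {0..<\<delta> r' div 2}"
    and "[int (l ^ (m - r) * g ^ k) * int q ^ i = c * int (l ^ (m - r') * g ^ k') * int q ^ i'] (mod int l ^ m)"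
    and "c = 1 \<or> c = -1"
  shows "r = r' \<and> k = k'"
proof -
  have nd: "\<not> int l dvd int g ^ k * int q ^ i" "\<not> int l dvd c * (int g ^ k' * int q ^ i')"
    using assms(6) prime_int_l not_dvd_g_power not_dvd_q_power by (auto simp: prime_dvd_mult_iff)
  have "[int l ^ (m - r) * (int g ^ k * int q ^ i)
      = int l ^ (m - r') * (c * (int g ^ k' * int q ^ i'))] (mod int l ^ m)"
    using assms(5) by (simp add: mult_ac)
  from valuation_cong[OF _ _ nd this]
  have "m - r = m - r'" and "[int g ^ k * int q ^ i = c * (int g ^ k' * int q ^ i')] (mod int l ^ (m - (m - r)))"
    using assms(1,2) by auto
  moreover from this have "r = r'" using assms(1,2) by auto
  ultimately show ?thesis
    using half_transversal_unique[of r k k' i c i'] assms by auto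
qed

end

section \<open>The roots of X^(2 l^m) + 1\<close>

text \<open>Used to compare the number of nonzero cosets with the size of the signed transversal,
  where the correspondence is given as a relation rather than a function.\<close>

lemma card_eq_if_unique_relation:
  assumes "\<And>a. a \<in> A \<Longrightarrow> \<exists>!b. b \<in> B \<and> P a b" "\<And>b. b \<in> B \<Longrightarrow> \<exists>!a. a \<in> A \<and> P a b"
  shows "card A = card B"
proof (rule bij_betw_same_card)
  define h where "h a = (THE b. b \<in> B \<and> P a b)" for a
  have h: "h a \<in> B" "P a (h a)" if "a \<in> A" for a
    using theI'[OF assms(1)[OF that]] by (auto simp: h_def)
  show "bij_betw h A B"
    unfolding bij_betw_def
  proof (intro conjI inj_onI equalityI subsetI)
    fix x y assume "x \<in> A" "y \<in> A" "h x = h y"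
    then show "x = y" using assms(2)[of "h x"] h by metis
  next
    fix b assume "b \<in> B"
    then obtain a where "a \<in> A" "P a b" using assms(2) by blast
    then show "b \<in> h ` A" using assms(1)[of a] h \<open>b \<in> B\<close> by blast
  qed (use h in auto)
qed

text \<open>Here \<open>t\<close> stands for \<open>\<beta>\<close> or \<open>\<theta>\<close>. The
  effect of Frobenius on \<open>t\<close> is left open and enters as a separate assumption in each
  case.\<close>

locale negacyclic_2lm = odd_prime_power_modulus l m q
  for l m q :: nat +
  fixes p n e :: nat and \<eta> t :: "'b::{field, finite}" and \<rho> :: "nat \<Rightarrow> int"
  assumes char_p: "CHAR('b) = p" and prime_char: "prime p" and odd_p: "odd p"
    and q_prime_power: "\<exists>a. q = p ^ a"
    and eta: "prim_root_unity \<eta> (l ^ m)" and t_square: "t ^ 2 = -1"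
    and reps: "coset_reps q (l ^ m) \<rho> e"
begin

text \<open>Integer exponents turn inversion of roots into negation.\<close>

definition E :: "int \<Rightarrow> 'b" where "E s = \<eta> powi s"

lemma M_pos: "l ^ m > 0"
  using prime_l by (simp add: prime_gt_0_nat)

lemma eta_power_M: "\<eta> ^ (l ^ m) = 1"
  using eta by (simp add: prim_root_unity_def)

lemma eta_nonzero: "\<eta> \<noteq> 0"
  using eta_power_M M_pos by (auto simp: power_0_left)

lemma E_add: "E (a + b) = E a * E b"
  using eta_nonzero by (simp add: E_def power_int_add)

lemma E_minus: "E (- a) = inverse (E a)"
  by (simp add: E_def power_int_minus)

lemma E_mult: "E (a * int k) = E a ^ k"
  by (simp add: E_def power_int_mult)

lemma E_nonzero: "E a \<noteq> 0"
  using eta_nonzero by (simp add: E_def)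

lemma E_0 [simp]: "E 0 = 1"
  by (simp add: E_def)

lemma E_M_mult: "E (int l ^ m * k) = 1"
proof -
  have "E (int (l ^ m) * k) = (\<eta> powi int (l ^ m)) powi k"
    unfolding E_def by (rule power_int_mult)
  also have "\<eta> powi int (l ^ m) = 1" by (simp only: power_int_of_nat eta_power_M)
  finally show ?thesis by simp
qed

lemma E_mod: "E (a mod int l ^ m) = E a"
proof -
  have "E a = E (int l ^ m * (a div int l ^ m) + a mod int l ^ m)" by simp
  then show ?thesis by (simp only: E_add E_M_mult mult_1_left)
qed

lemma E_of_nonneg: "a \<ge> 0 \<Longrightarrow> E a = \<eta> ^ nat a"
  by (simp add: E_def power_int_def)

lemma E_eq_1_iff: "E a = 1 \<longleftrightarrow> int l ^ m dvd a"
proof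
  assume *: "E a = 1"
  let ?r = "a mod int l ^ m"
  have M: "0 < int l ^ m" using M_pos by simp
  have r: "0 \<le> ?r" "?r < int l ^ m" using M by (rule pos_mod_sign, rule pos_mod_bound)
  have "\<eta> ^ nat ?r = 1" using * E_mod[of a] E_of_nonneg[OF r(1)] by simp
  moreover have "nat ?r < l ^ m" using r by (simp add: nat_less_iff)
  ultimately have "nat ?r = 0" using eta unfolding prim_root_unity_def by (metis gr0I)
  then show "int l ^ m dvd a" using r by (simp add: dvd_eq_mod_eq_0)
qed (auto simp: E_M_mult)

lemma E_eq_iff: "E a = E b \<longleftrightarrow> [a = b] (mod int l ^ m)"
proof -
  have "E (a - b) * E b = E a" by (simp flip: E_add)
  then have "E a = E b \<longleftrightarrow> E (a - b) = 1" using E_nonzero[of b] by auto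
  then show ?thesis by (simp add: E_eq_1_iff cong_iff_dvd_diff)
qed

lemma one_neq_minus_one: "(1 :: 'b) \<noteq> -1"
proof
  assume "(1 :: 'b) = -1"
  then have "of_nat 2 = (0 :: 'b)" by (simp add: eq_neg_iff_add_eq_0)
  then have "p dvd 2" by (simp only: of_nat_eq_0_iff_char_dvd char_p)
  then show False using prime_char odd_p by (metis primes_dvd_imp_eq two_is_prime_nat even_numeral dvd_refl)
qed

lemma t_nonzero: "t \<noteq> 0"
  using t_square by auto

lemma inverse_t: "inverse t = - t"
proof -
  have "t * (- t) = 1" using t_square by (simp add: power2_eq_square)
  then show ?thesis by (rule inverse_unique)
qed

text \<open>Raising \<open>E a = - E b\<close> to the odd power \<open>l^m\<close> would give
  \<open>1 = -1\<close>, which odd characteristic excludes.\<close>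

lemma opposite_signs: "t * E a \<noteq> - t * E b" "- t * E b \<noteq> t * E a"
proof -
  have "E a \<noteq> - E b"
  proof
    assume "E a = - E b"
    then have "E a ^ (l ^ m) = - (E b ^ (l ^ m))" using odd_l by simp
    moreover have "E c ^ (l ^ m) = 1" for c
      using E_M_mult[of c] E_mult[of c "l ^ m"] by (simp add: mult.commute)
    ultimately show False using one_neq_minus_one by simp
  qed
  then show "t * E a \<noteq> - t * E b" "- t * E b \<noteq> t * E a" using t_nonzero
    by (auto simp flip: mult_minus_right)
qed

lemma same_signs:
  "t * E a = t * E b \<longleftrightarrow> [a = b] (mod int l ^ m)"
  "- t * E a = - t * E b \<longleftrightarrow> [a = b] (mod int l ^ m)"
  using t_nonzero by (simp_all add: E_eq_iff)

lemma root_power: "(t * E s) ^ (2 * l ^ m) = -1" "(- t * E s) ^ (2 * l ^ m) = -1"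
proof -
  have "E s ^ (l ^ m) = 1"
    using E_M_mult[of s] E_mult[of s "l ^ m"] by (simp add: mult.commute)
  then have "E s ^ (2 * l ^ m) = 1" by (simp add: mult.commute[of 2] power_mult)
  moreover have "t ^ (2 * l ^ m) = -1" "(- t) ^ (2 * l ^ m) = -1"
    using t_square odd_l by (simp_all add: power_mult)
  ultimately show "(t * E s) ^ (2 * l ^ m) = -1" "(- t * E s) ^ (2 * l ^ m) = -1"
    by (simp_all only: power_mult_distrib mult_1_right)
qed

text \<open>Exponents from 0 to \<open>l^m - 1\<close> with both signs already give
  \<open>2 l^m\<close> distinct roots, and the degree allows no more.\<close>

lemma roots_eq: "{w. w ^ (2 * l ^ m) = -1} = range (\<lambda>s. t * E s) \<union> range (\<lambda>s. - t * E s)"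
  and card_roots: "card {w::'b. w ^ (2 * l ^ m) = -1} = 2 * l ^ m"
proof -
  let ?R = "{w::'b. w ^ (2 * l ^ m) = -1}"
  let ?D = "{0..<int l ^ m}"
  let ?T = "(\<lambda>s. t * E s) ` ?D \<union> (\<lambda>s. - t * E s) ` ?D"
  have "inj_on (\<lambda>s. t * E s) ?D" "inj_on (\<lambda>s. - t * E s) ?D"
    unfolding inj_on_def same_signs by (auto intro: cong_less_imp_eq_int)
  then have "card ?T = 2 * l ^ m"
    using opposite_signs by (subst card_Un_disjoint) (auto simp: card_image nat_power_eq)
  moreover have sub: "?T \<subseteq> range (\<lambda>s. t * E s) \<union> range (\<lambda>s. - t * E s)"
    "range (\<lambda>s. t * E s) \<union> range (\<lambda>s. - t * E s) \<subseteq> ?R"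
    using root_power by auto
  have "?R = {w. poly (xN1 (2 * l ^ m)) w = 0}"
    by (auto simp: xN1_def poly_monom eq_neg_iff_add_eq_0)
  then have "card ?R \<le> 2 * l ^ m"
    using card_poly_roots_bound[of "xN1 (2 * l ^ m) :: 'b poly"] M_pos
    by (simp add: xN1_nonzero degree_xN1)
  ultimately have "?T = ?R"
    by (intro card_seteq subset_trans[OF sub]) simp_all
  then show "?R = range (\<lambda>s. t * E s) \<union> range (\<lambda>s. - t * E s)" "card ?R = 2 * l ^ m"
    using sub \<open>card ?T = 2 * l ^ m\<close> by auto
qed

abbreviation R :: "'b set" where "R \<equiv> {w. w ^ (2 * l ^ m) = -1}"

sublocale split_negacyclic p q n "2 * l ^ m" R
  by unfold_locales (use char_p prime_char q_prime_power M_pos card_roots in auto)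

section \<open>Sign and exponent as coordinates of a root\<close>

definition rt :: "bool \<Rightarrow> int \<Rightarrow> 'b" where
  "rt b s = (if b then t else - t) * E s"

lemma rt_eq_iff: "rt b s = rt c u \<longleftrightarrow> b = c \<and> [s = u] (mod int l ^ m)"
  unfolding rt_def using same_signs opposite_signs by (cases b; cases c) (simp_all del: mult_minus_left)

lemma rt_in_R: "rt b s \<in> R"
  using root_power by (simp add: rt_def del: mult_minus_left)

lemma R_cases:
  assumes "x \<in> R"
  obtains b s where "x = rt b s"
proof -
  have "x \<in> range (\<lambda>s. t * E s) \<union> range (\<lambda>s. - t * E s)" using assms roots_eq by simp
  then show ?thesis using that[of True] that[of False] by (auto simp: rt_def)
qed

lemma inverse_rt: "inverse (rt b s) = rt (\<not> b) (- s)"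
  by (simp add: rt_def inverse_t E_minus)

lemma root_set_eqI:
  assumes "A \<subseteq> R" "B \<subseteq> R" and mem: "\<And>b s. rt b s \<in> A \<longleftrightarrow> rt b s \<in> B"
  shows "A = B"
proof (intro equalityI subsetI)
  fix x assume x: "x \<in> A"
  then obtain b s where "x = rt b s" using R_cases assms(1) by blast
  then show "x \<in> B" using x mem by simp
next
  fix x assume x: "x \<in> B"
  then obtain b s where "x = rt b s" using R_cases assms(2) by blast
  then show "x \<in> A" using x mem by simp
qed

text \<open>Each factor becomes \<open>c X - \<eta>^s = c (X - \<eta>^s / c)\<close>, and
  \<open>hat\<close> strips the accumulated power of \<open>c\<close>.\<close>

lemma hat_scaleX_prod:
  assumes "c \<noteq> 0" "S \<subseteq> {0..<int l ^ m}"
  shows "hat (scaleX (\<Prod>s\<in>S. [:- (\<eta> ^ nat s), 1:]) c) = root_prod ((\<lambda>s. E s / c) ` S)"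
proof -
  let ?P = "\<Prod>s\<in>S. [:- (E s / c), 1:]"
  have "scaleX (\<Prod>s\<in>S. [:- (\<eta> ^ nat s), 1:]) c = (\<Prod>s\<in>S. smult c [:- (E s / c), 1:])"
    unfolding scaleX_def pcompose_prod
    using assms by (intro prod.cong) (auto simp: pcompose_pCons E_of_nonneg)
  also have "\<dots> = smult (\<Prod>s\<in>S. c) ?P" by (rule prod_smult)
  finally have eq: "scaleX (\<Prod>s\<in>S. [:- (\<eta> ^ nat s), 1:]) c = smult (\<Prod>s\<in>S. c) ?P" .
  have "lead_coeff ?P = 1" by (simp only: lead_coeff_prod) simp
  then have "hat (smult (\<Prod>s\<in>S. c) ?P) = ?P"
    using assms(1) by (simp add: hat_def lead_coeff_smult)
  moreover have "inj_on (\<lambda>s. E s / c) S"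
    unfolding inj_on_def using assms
    by (auto simp: E_eq_iff intro!: cong_less_imp_eq_int[of _ "int l ^ m"] dest: subsetD)
  then have "root_prod ((\<lambda>s. E s / c) ` S) = ?P"
    unfolding root_prod_def by (subst prod.reindex) auto
  ultimately show ?thesis unfolding eq by simp
qed

text \<open>Since \<open>1/t = -t\<close>, substituting \<open>t X\<close> yields the roots with the
  opposite sign \<open>False\<close>. The multiplier \<open>k\<close> is kept general to serve both
  \<open>q\<close> for \<open>Mpoly\<close> and \<open>q^2\<close> for \<open>Npoly\<close>.\<close>

lemma hat_coset_poly:
  "hat (scaleX (\<Prod>s\<in>cyc_coset k (l ^ m) u. [:- (\<eta> ^ nat s), 1:]) t)
    = root_prod (range (\<lambda>i. rt False (u * int k ^ i)))"
  "hat (scaleX (\<Prod>s\<in>cyc_coset k (l ^ m) u. [:- (\<eta> ^ nat s), 1:]) (- t))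
    = root_prod (range (\<lambda>i. rt True (u * int k ^ i)))"
proof -
  have coset: "cyc_coset k (l ^ m) u = range (\<lambda>i. (u * int k ^ i) mod int l ^ m)"
    by (auto simp: cyc_coset_def)
  have M: "0 < int l ^ m" using M_pos by simp
  have sub: "cyc_coset k (l ^ m) u \<subseteq> {0..<int l ^ m}"
    unfolding coset using pos_mod_sign[OF M] pos_mod_bound[OF M] by auto
  have div: "E s / t = rt False s" "E s / - t = rt True s" for s
    using inverse_t by (simp_all add: divide_inverse rt_def)
  have rt_mod: "rt b (s mod int l ^ m) = rt b s" for b s
    by (simp add: rt_def E_mod)
  show "hat (scaleX (\<Prod>s\<in>cyc_coset k (l ^ m) u. [:- (\<eta> ^ nat s), 1:]) t)
      = root_prod (range (\<lambda>i. rt False (u * int k ^ i)))"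
    unfolding hat_scaleX_prod[OF t_nonzero sub] unfolding coset image_image div rt_mod ..
  show "hat (scaleX (\<Prod>s\<in>cyc_coset k (l ^ m) u. [:- (\<eta> ^ nat s), 1:]) (- t))
      = root_prod (range (\<lambda>i. rt True (u * int k ^ i)))"
    by (subst hat_scaleX_prod[OF _ sub])
       (use t_nonzero in simp, unfold coset image_image div rt_mod, rule refl)
qed

lemmas hat_Mpoly = hat_coset_poly[of q, folded Mpoly_def]
lemmas hat_Npoly = hat_coset_poly[of "q\<^sup>2", folded Npoly_def]

text \<open>Membership of \<open>s\<close> in the \<open>q\<close>-cyclotomic coset of
  \<open>u\<close>, stated for unreduced integers so that negation and multiplication need no
  reduction.\<close>

definition rel :: "int \<Rightarrow> int \<Rightarrow> bool" where
  "rel s u \<longleftrightarrow> (\<exists>i. [s = u * int q ^ i] (mod int l ^ m))"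

lemma rel_refl: "rel s s"
  unfolding rel_def by (auto intro!: exI[of _ 0])

lemma rel_trans: "rel a b \<Longrightarrow> rel b c \<Longrightarrow> rel a c"
proof -
  assume "rel a b" "rel b c"
  then obtain i j where "[a = b * int q ^ i] (mod int l ^ m)" "[b = c * int q ^ j] (mod int l ^ m)"
    by (auto simp: rel_def)
  then have "[a = c * int q ^ j * int q ^ i] (mod int l ^ m)"
    using cong_scalar_right cong_trans by blast
  then have "[a = c * int q ^ (j + i)] (mod int l ^ m)" by (simp add: power_add mult.assoc)
  then show ?thesis unfolding rel_def by blast
qed

lemma rel_sym:
  assumes "rel a b"
  shows "rel b a"
proof -
  obtain i where i: "[a = b * int q ^ i] (mod int l ^ m)" using assms by (auto simp: rel_def)
  define d where "d = f * l ^ (m - 1)"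
  have d: "[int q ^ d = 1] (mod int l ^ m)" unfolding d_def by (rule q_power_period)
  have d1: "d \<ge> 1" unfolding d_def using f_pos prime_l by (simp add: prime_gt_0_nat Suc_le_eq)
  \<comment> \<open>The complement of \<open>i\<close> to a multiple of the period: multiplying by
    \<open>q^?j\<close> inverts \<open>q^i\<close> without negative exponents.\<close>
  let ?j = "d * i - i"
  have e: "i + ?j = d * i" using d1 by simp
  have "[a * int q ^ ?j = b * int q ^ i * int q ^ ?j] (mod int l ^ m)"
    using i by (rule cong_scalar_right)
  also have "b * int q ^ i * int q ^ ?j = b * (int q ^ d) ^ i"
    by (simp only: mult.assoc power_add[symmetric] e power_mult)
  also have "[b * (int q ^ d) ^ i = b * 1 ^ i] (mod int l ^ m)"
    using d by (intro cong_scalar_left cong_pow)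
  finally have "[b = a * int q ^ ?j] (mod int l ^ m)" by (simp add: cong_sym_eq)
  then show ?thesis unfolding rel_def by blast
qed

lemma rel_minus: "rel (- a) (- b) \<longleftrightarrow> rel a b"
  unfolding rel_def by (simp add: cong_minus_minus_iff)

lemma rel_dvd_iff: "rel a b \<Longrightarrow> int l ^ m dvd a \<longleftrightarrow> int l ^ m dvd b"
  using rel_sym[of a b] by (auto simp: rel_def cong_dvd_iff)

lemma dvd_imp_rel_0: "int l ^ m dvd a \<Longrightarrow> rel a 0"
  by (simp add: rel_def cong_0_iff)

lemma cyc_coset_mono: "rel a b \<Longrightarrow> cyc_coset q (l ^ m) a \<subseteq> cyc_coset q (l ^ m) b"
proof
  fix x assume ab: "rel a b" and "x \<in> cyc_coset q (l ^ m) a"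
  then obtain i where x: "x = (a * int q ^ i) mod int l ^ m" by (auto simp: cyc_coset_def)
  then have "[x = a * int q ^ i] (mod int l ^ m)" by simp
  then have "rel x a" unfolding rel_def by blast
  then obtain j where "[x = b * int q ^ j] (mod int l ^ m)"
    using rel_trans ab unfolding rel_def by blast
  moreover have "x mod int l ^ m = x" by (simp add: x)
  ultimately have "x = (b * int q ^ j) mod int l ^ m" by (simp add: cong_def)
  then show "x \<in> cyc_coset q (l ^ m) b" by (auto simp: cyc_coset_def)
qed

lemma rho_0: "\<rho> 0 = 0"
  using reps by (simp add: coset_reps_def)

lemma rho_unique: "j \<le> e \<Longrightarrow> k \<le> e \<Longrightarrow> rel s (\<rho> j) \<Longrightarrow> rel s (\<rho> k) \<Longrightarrow> j = k"
proof -
  assume jk: "j \<le> e" "k \<le> e" "rel s (\<rho> j)" "rel s (\<rho> k)"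
  then have "rel (\<rho> j) (\<rho> k)" using rel_sym rel_trans by blast
  then have "cyc_coset q (l ^ m) (\<rho> j) = cyc_coset q (l ^ m) (\<rho> k)"
    using cyc_coset_mono rel_sym by blast
  then show "j = k" using reps jk by (auto simp: coset_reps_def)
qed

lemma rho_exists: "\<exists>j\<le>e. rel s (\<rho> j)"
proof -
  have "0 \<le> s mod int (l ^ m)" "s mod int (l ^ m) < int (l ^ m)"
    using M_pos by (simp_all only: pos_mod_sign pos_mod_bound of_nat_0_less_iff)
  then obtain j where j: "j \<le> e" "s mod int (l ^ m) \<in> cyc_coset q (l ^ m) (\<rho> j)"
    using reps unfolding coset_reps_def by blast
  then have "rel s (\<rho> j)" by (auto simp: cyc_coset_def rel_def cong_def)
  then show ?thesis using j by blast
qed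

text \<open>The class 0 is a coset by itself, already represented by
  \<open>\<rho> 0\<close>.\<close>

lemma rho_pos_not_dvd: "k \<in> {1..e} \<Longrightarrow> \<not> int l ^ m dvd \<rho> k"
  using rho_unique[of k 0 "\<rho> k"] rel_refl dvd_imp_rel_0 by (auto simp: rho_0)

lemma ex1_rho_pos:
  assumes "\<not> int l ^ m dvd s"
  shows "\<exists>!k. k \<in> {1..e} \<and> rel s (\<rho> k)"
proof -
  obtain k where k: "k \<le> e" "rel s (\<rho> k)" using rho_exists by blast
  then have "k \<noteq> 0" using assms rel_dvd_iff by (metis dvd_0_right rho_0)
  then show ?thesis using k rho_unique by (intro ex1I[of _ k]) auto
qed

lemma E_mult_power: "E a ^ (q ^ i) = E (a * int q ^ i)"
  using E_mult[of a "q ^ i"] by simp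

lemma orbit_subset_R: "w \<in> R \<Longrightarrow> orbit w \<subseteq> R"
  using stable_orbit[of w] unfolding stable_def by blast

lemma root_prod_mult:
  assumes "A \<inter> B = {}" "A \<union> B = C"
  shows "root_prod A * root_prod B = root_prod C"
  using root_prod_Un[OF assms(1)] assms(2) by simp

lemma rt_in_range_iff: "rt b s \<in> range (\<lambda>i. rt c (u * int q ^ i)) \<longleftrightarrow> b = c \<and> rel s u"
  by (auto simp: image_iff rt_eq_iff rel_def)

lemma range_rt_subset_R: "range (\<lambda>i. rt b (v i)) \<subseteq> R"
  using rt_in_R by blast

section \<open>The case where Frobenius fixes the square root of -1\<close>

lemma rt_power_fixed:
  assumes "t ^ q = t"
  shows "rt b s ^ (q ^ i) = rt b (s * int q ^ i)"
proof -
  have "t ^ (q ^ i) = t \<and> (- t) ^ (q ^ i) = - t"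
    by (induction i) (simp_all add: power_mult assms power_q_minus)
  then show ?thesis by (simp add: rt_def power_mult_distrib E_mult_power)
qed

lemma LCD_codes_fixed:
  assumes tq: "t ^ q = t"
  shows "LCD_negacyclic_codes q (2 * l ^ m * p ^ n) =
      {gen_code q (2 * l ^ m * p ^ n)
        (\<Prod>i\<in>{0..e}. hat (scaleX (Mpoly \<eta> q (l ^ m) (\<rho> i)) t) ^ \<epsilon> i
          * hat (scaleX (Mpoly \<eta> q (l ^ m) (- \<rho> i)) (- t)) ^ \<epsilon> i)
        | \<epsilon>. \<forall>i\<le>e. \<epsilon> i \<in> {0, p ^ n}}"
    and "card (LCD_negacyclic_codes q (2 * l ^ m * p ^ n) :: 'b poly set set) = 2 ^ (e + 1)"
proof -
  let ?w = "\<lambda>i. rt False (\<rho> i)"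
  have mem: "rt b s \<in> orbit (rt c u) \<longleftrightarrow> (if b = c then rel s u else rel s (- u))" for b c s u
    unfolding orbit_def inverse_rt rt_power_fixed[OF tq] Un_iff rt_in_range_iff by auto
  have prod: "hat (scaleX (Mpoly \<eta> q (l ^ m) u) t) * hat (scaleX (Mpoly \<eta> q (l ^ m) (- u)) (- t))
      = root_prod (orbit (rt False u))" for u
    unfolding hat_Mpoly
  proof (rule root_prod_mult)
    show "range (\<lambda>i. rt False (u * int q ^ i)) \<inter> range (\<lambda>i. rt True (- u * int q ^ i)) = {}"
      by (auto simp: rt_eq_iff)
    show "range (\<lambda>i. rt False (u * int q ^ i)) \<union> range (\<lambda>i. rt True (- u * int q ^ i))
        = orbit (rt False u)"
    proof (rule root_set_eqI)
      fix b s
      show "rt b s \<in> range (\<lambda>i. rt False (u * int q ^ i)) \<union> range (\<lambda>i. rt True (- u * int q ^ i))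
          \<longleftrightarrow> rt b s \<in> orbit (rt False u)"
        unfolding Un_iff rt_in_range_iff mem by (cases b) auto
    qed (rule Un_least range_rt_subset_R orbit_subset_R rt_in_R)+
  qed
  have unique: "\<exists>!j. j \<in> {0..e} \<and> x \<in> orbit (?w j)" if xR: "x \<in> R" for x
  proof -
    obtain b s where x: "x = rt b s" using R_cases[OF xR] .
    \<comment> \<open>A root of sign \<open>True\<close> is inverted first, which moves it to sign
      \<open>False\<close> and negates its exponent; so the sign-\<open>False\<close> cosets alone
      index the orbits.\<close>
    have eq: "x \<in> orbit (?w j) \<longleftrightarrow> rel (if b then - s else s) (\<rho> j)" for j
      unfolding x mem using rel_minus[of s "- \<rho> j"] by auto
    obtain j where "j \<le> e" "rel (if b then - s else s) (\<rho> j)" using rho_exists by blast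
    then show ?thesis unfolding eq using rho_unique by (intro ex1I[of _ j]) auto
  qed
  show "LCD_negacyclic_codes q (2 * l ^ m * p ^ n) =
      {gen_code q (2 * l ^ m * p ^ n)
        (\<Prod>i\<in>{0..e}. hat (scaleX (Mpoly \<eta> q (l ^ m) (\<rho> i)) t) ^ \<epsilon> i
          * hat (scaleX (Mpoly \<eta> q (l ^ m) (- \<rho> i)) (- t)) ^ \<epsilon> i)
        | \<epsilon>. \<forall>i\<le>e. \<epsilon> i \<in> {0, p ^ n}}"
    unfolding power_mult_distrib[symmetric] prod
    using LCD_codes_orbits[of "{0..e}" ?w, OF _ rt_in_R unique] by (simp add: Ball_def)
  show "card (LCD_negacyclic_codes q (2 * l ^ m * p ^ n) :: 'b poly set set) = 2 ^ (e + 1)"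
    using card_LCD_codes_orbits[of "{0..e}" ?w, OF _ rt_in_R unique] by simp
qed

text \<open>Refines \<open>rel\<close> by the parity of the exponent of \<open>q\<close>, because a
  Frobenius map negating \<open>t\<close> flips the sign once per step. Both parities may hold for
  the same pair.\<close>

definition relp :: "bool \<Rightarrow> int \<Rightarrow> int \<Rightarrow> bool" where
  "relp b s u \<longleftrightarrow> (\<exists>i. even i = b \<and> [s = u * int q ^ i] (mod int l ^ m))"

lemma rel_iff_relp: "rel s u \<longleftrightarrow> relp True s u \<or> relp False s u"
  by (auto simp: rel_def relp_def)

text \<open>Multiplication by \<open>q^h\<close> absorbs the minus sign and shifts the exponent by
  \<open>h\<close>, so the parity changes exactly when \<open>h\<close> is odd.\<close>

lemma relp_minus:
  assumes "[int q ^ h = -1] (mod int l ^ m)"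
  shows "relp b s (- u) \<longleftrightarrow> relp (b = even h) s u"
proof -
  have step: "relp (b = even h) s (- u)" if r: "relp b s u" for b u
  proof -
    obtain i where i: "even i = b" "[s = u * int q ^ i] (mod int l ^ m)"
      using r by (auto simp: relp_def)
    have "[- u * int q ^ i * int q ^ h = - u * int q ^ i * -1] (mod int l ^ m)"
      using assms by (rule cong_scalar_left)
    then have "[s = - u * int q ^ (i + h)] (mod int l ^ m)"
      using i(2) by (simp add: power_add mult.assoc) (meson cong_sym cong_trans)
    moreover have "even (i + h) = (b = even h)" using i(1) by auto
    ultimately show ?thesis unfolding relp_def by blast
  qed
  show ?thesis
    using step[of b "- u"] step[of "b = even h" u] by (cases "even h") auto
qed

text \<open>Powers of \<open>q^2\<close> are the even powers of \<open>q\<close>; the extra factor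
  \<open>q\<close> makes them odd.\<close>

lemma range_rt_square_iff:
  "rt b s \<in> range (\<lambda>i. rt c (u * int (q\<^sup>2) ^ i)) \<longleftrightarrow> b = c \<and> relp True s u"
  "rt b s \<in> range (\<lambda>i. rt c (u * int q * int (q\<^sup>2) ^ i)) \<longleftrightarrow> b = c \<and> relp False s u"
proof -
  have pow: "int (q\<^sup>2) ^ i = int q ^ (2 * i)" "int q * int q ^ (2 * i) = int q ^ (2 * i + 1)" for i
    by (simp_all add: power_mult)
  have "(\<exists>i. even i \<and> P i) \<longleftrightarrow> (\<exists>i. P (2 * i))" "(\<exists>i. odd i \<and> P i) \<longleftrightarrow> (\<exists>i. P (2 * i + 1))" for P :: "nat \<Rightarrow> bool"
    by (metis dvd_triv_left evenE) (metis oddE even_mult_iff even_plus_one_iff even_numeral)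
  then show "rt b s \<in> range (\<lambda>i. rt c (u * int (q\<^sup>2) ^ i)) \<longleftrightarrow> b = c \<and> relp True s u"
    "rt b s \<in> range (\<lambda>i. rt c (u * int q * int (q\<^sup>2) ^ i)) \<longleftrightarrow> b = c \<and> relp False s u"
    by (simp_all only: relp_def image_iff rt_eq_iff mult.assoc pow) auto
qed

lemma relp_parity_unique:
  assumes "even f" "\<not> int l ^ m dvd u" "relp b s u" "relp c s u"
  shows "b = c"
proof -
  obtain i j where "even i = b" "even j = c"
    "[s = u * int q ^ i] (mod int l ^ m)" "[s = u * int q ^ j] (mod int l ^ m)"
    using assms(3,4) by (auto simp: relp_def)
  then show ?thesis using same_parity[OF assms(1,2)] by (meson cong_sym cong_trans)
qed

text \<open>When \<open>t^q = -t\<close>, these are the pure Frobenius orbits of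
  \<open>rt False u\<close> and, for \<open>T_set\<close>, of \<open>rt True u\<close>: the sign
  alternates with the parity of the exponent.\<close>

abbreviation "S_set u \<equiv> range (\<lambda>i. rt False (u * int (q\<^sup>2) ^ i)) \<union> range (\<lambda>i. rt True (u * int q * int (q\<^sup>2) ^ i))"
abbreviation "T_set u \<equiv> range (\<lambda>i. rt True (u * int (q\<^sup>2) ^ i)) \<union> range (\<lambda>i. rt False (u * int q * int (q\<^sup>2) ^ i))"

lemma rt_in_S_set_iff: "rt b s \<in> S_set u \<longleftrightarrow> relp (\<not> b) s u"
  unfolding Un_iff range_rt_square_iff(2) unfolding range_rt_square_iff(1) by (cases b) auto

lemma rt_in_T_set_iff: "rt b s \<in> T_set u \<longleftrightarrow> relp b s u"
  unfolding Un_iff range_rt_square_iff(2) unfolding range_rt_square_iff(1) by (cases b) auto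

lemma S_poly: "hat (scaleX (Npoly \<eta> q (l ^ m) u) t) * hat (scaleX (Npoly \<eta> q (l ^ m) (u * int q)) (- t))
    = root_prod (S_set u)"
  unfolding hat_Npoly by (rule root_prod_mult) (auto simp: rt_eq_iff)

lemma T_poly: "hat (scaleX (Npoly \<eta> q (l ^ m) u) (- t)) * hat (scaleX (Npoly \<eta> q (l ^ m) (u * int q)) t)
    = root_prod (T_set u)"
  unfolding hat_Npoly by (rule root_prod_mult) (auto simp: rt_eq_iff)

section \<open>The case where Frobenius negates the square root of -1\<close>

context
  assumes tq: "t ^ q = - t"
begin

lemma rt_power: "rt b s ^ (q ^ i) = rt (b = even i) (s * int q ^ i)"
proof -
  have "t ^ (q ^ i) = (if even i then t else - t) \<and> (- t) ^ (q ^ i) = (if even i then - t else t)"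
    by (induction i) (auto simp: power_mult tq power_q_minus mult.commute[of q])
  then show ?thesis by (auto simp: rt_def power_mult_distrib E_mult_power)
qed

lemma rt_in_orbit_iff:
  "rt b s \<in> orbit (rt c u) \<longleftrightarrow> relp (b = c) s u \<or> relp (b \<noteq> c) s (- u)"
  unfolding orbit_def inverse_rt rt_power
  by (auto simp: image_iff rt_eq_iff relp_def)

lemma rt_in_orbit_0_iff: "rt b s \<in> orbit (rt True 0) \<longleftrightarrow> int l ^ m dvd s"
proof -
  \<comment> \<open>The exponents 0 and 1 of \<open>q\<close> witness the two parities, so the class
    0 occurs with both signs.\<close>
  have "relp c s 0 \<longleftrightarrow> int l ^ m dvd s" for c
    by (cases c) (auto simp: relp_def cong_0_iff intro: exI[of _ 0] exI[of _ 1])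
  then show ?thesis unfolding rt_in_orbit_iff by simp
qed

lemma root_prod_orbit_0: "root_prod (orbit (rt True 0)) = [:1, 0, 1:]"
proof -
  have "orbit (rt True 0) = {rt True 0, rt False 0}"
    by (rule root_set_eqI)
       (use orbit_subset_R[OF rt_in_R] rt_in_R in \<open>auto simp: rt_in_orbit_0_iff rt_eq_iff cong_0_iff\<close>)
  moreover have "rt True 0 \<noteq> rt False 0" by (simp add: rt_eq_iff)
  ultimately have "root_prod (orbit (rt True 0)) = [:- rt True 0, 1:] * [:- rt False 0, 1:]"
    by (simp add: root_prod_def)
  then show ?thesis using t_square by (simp add: rt_def power2_eq_square)
qed

text \<open>Disposes of the orbit of \<open>t\<close> and \<open>-t\<close>, whose polynomial is
  \<open>X^2 + 1\<close>. Each remaining case only has to supply representatives for the orbits with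
  nonzero exponent.\<close>

lemma LCD_codes_by_coordinates:
  fixes I :: "'i set"
  assumes "finite I" and nz: "\<And>i. i \<in> I \<Longrightarrow> \<not> int l ^ m dvd u i"
    and unique: "\<And>b s. \<not> int l ^ m dvd s \<Longrightarrow> \<exists>!i. i \<in> I \<and> rt b s \<in> orbit (rt (c i) (u i))"
  shows "LCD_negacyclic_codes q (2 * l ^ m * p ^ n) =
      {gen_code q (2 * l ^ m * p ^ n)
        ([:1, 0, 1:] ^ \<epsilon>0 * (\<Prod>i\<in>I. root_prod (orbit (rt (c i) (u i))) ^ \<epsilon> i))
        | \<epsilon>0 \<epsilon>. \<epsilon>0 \<in> {0, p ^ n} \<and> (\<forall>i\<in>I. \<epsilon> i \<in> {0, p ^ n})}"
    and "card (LCD_negacyclic_codes q (2 * l ^ m * p ^ n) :: 'b poly set set) = 2 ^ (1 + card I)"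
proof -
  have disj: "x \<notin> orbit (rt (c i) (u i))" if "i \<in> I" and x0: "x \<in> orbit (rt True 0)" for i x
  proof
    assume x: "x \<in> orbit (rt (c i) (u i))"
    have "x \<in> R" using orbit_subset_R[OF rt_in_R] x0 by blast
    then obtain b s where s: "x = rt b s" using R_cases by blast
    then have "rel s (u i) \<or> rel s (- u i)"
      using x unfolding s rt_in_orbit_iff rel_iff_relp by metis
    moreover have "int l ^ m dvd s" using x0 rt_in_orbit_0_iff s by simp
    ultimately have "int l ^ m dvd u i" using rel_dvd_iff by force
    then show False using nz that by blast
  qed
  have uniq: "\<exists>!i. i \<in> I \<and> x \<in> orbit (rt (c i) (u i))" if x: "x \<in> R" "x \<notin> orbit (rt True 0)" for x
  proof -
    obtain b s where s: "x = rt b s" using R_cases x(1) by blast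
    then show ?thesis using unique x(2) rt_in_orbit_0_iff by simp
  qed
  note main = LCD_codes_orbits_insert[of I "rt True 0" "\<lambda>i. rt (c i) (u i)",
      unfolded root_prod_orbit_0]
  show "LCD_negacyclic_codes q (2 * l ^ m * p ^ n) =
      {gen_code q (2 * l ^ m * p ^ n)
        ([:1, 0, 1:] ^ \<epsilon>0 * (\<Prod>i\<in>I. root_prod (orbit (rt (c i) (u i))) ^ \<epsilon> i))
        | \<epsilon>0 \<epsilon>. \<epsilon>0 \<in> {0, p ^ n} \<and> (\<forall>i\<in>I. \<epsilon> i \<in> {0, p ^ n})}"
    by (rule main(1)) (rule assms(1) rt_in_R | erule (1) disj | erule (1) uniq)+
  show "card (LCD_negacyclic_codes q (2 * l ^ m * p ^ n) :: 'b poly set set) = 2 ^ (1 + card I)"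
    by (rule main(2)) (rule assms(1) rt_in_R | erule (1) disj | erule (1) uniq)+
qed

text \<open>Here -1 is an odd power of \<open>q\<close>, so inversion agrees with a Frobenius power.
  The orbits are the sets \<open>S_set\<close> and \<open>T_set\<close>, indexed by a coset and a
  sign, and parity keeps the two signs apart.\<close>

lemma LCD_codes_2_mod_4:
  assumes f: "f mod 4 = 2"
  shows "LCD_negacyclic_codes q (2 * l ^ m * p ^ n) =
      {gen_code q (2 * l ^ m * p ^ n) ([:1, 0, 1:] ^ \<epsilon>0 *
        (\<Prod>k\<in>{1..e}. root_prod (S_set (\<rho> k)) ^ \<epsilon> k * root_prod (T_set (\<rho> k)) ^ \<epsilon>' k))
        | \<epsilon>0 \<epsilon> \<epsilon>'. \<epsilon>0 \<in> {0, p ^ n} \<and> (\<forall>k\<in>{1..e}. \<epsilon> k \<in> {0, p ^ n} \<and> \<epsilon>' k \<in> {0, p ^ n})}"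
    (is "_ = ?rhs")
    and "card (LCD_negacyclic_codes q (2 * l ^ m * p ^ n) :: 'b poly set set) = 2 ^ (1 + 2 * e)"
proof -
  have ev: "even f" using f by presburger
  have "odd (f div 2)" using f by presburger
  then have odd2: "odd (f div 2 * l ^ (m - 1))" using odd_l by simp
  have mem: "rt b s \<in> orbit (rt c u) \<longleftrightarrow> relp (b = c) s u" for b c s u
    unfolding rt_in_orbit_iff relp_minus[OF q_power_minus_1[OF ev]] using odd2 by auto
  have S: "S_set u = orbit (rt False u)" for u
  proof (rule root_set_eqI)
    show "rt b s \<in> S_set u \<longleftrightarrow> rt b s \<in> orbit (rt False u)" for b s
      unfolding rt_in_S_set_iff mem by simp
  qed (rule Un_least range_rt_subset_R orbit_subset_R rt_in_R)+
  have T: "T_set u = orbit (rt True u)" for u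
  proof (rule root_set_eqI)
    show "rt b s \<in> T_set u \<longleftrightarrow> rt b s \<in> orbit (rt True u)" for b s
      unfolding rt_in_T_set_iff mem by simp
  qed (rule Un_least range_rt_subset_R orbit_subset_R rt_in_R)+
  let ?I = "{1..e} \<times> (UNIV :: bool set)"
  have unique: "\<exists>!i. i \<in> ?I \<and> rt b s \<in> orbit (rt (snd i) (\<rho> (fst i)))"
    if nd: "\<not> int l ^ m dvd s" for b s
  proof -
    obtain k where k: "k \<in> {1..e}" "rel s (\<rho> k)"
      and k_unique: "\<And>k'. k' \<in> {1..e} \<Longrightarrow> rel s (\<rho> k') \<Longrightarrow> k' = k"
      using ex1_rho_pos[OF nd] by blast
    obtain c where c: "relp c s (\<rho> k)" using k(2) by (auto simp: rel_iff_relp)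
    show ?thesis
    \<comment> \<open>Membership requires the parity to equal \<open>b = snd i\<close>. Since the
      parity is \<open>c\<close>, the sign of the representative must be
      \<open>b = c\<close>.\<close>
    proof (rule ex1I[of _ "(k, b = c)"])
      show "(k, b = c) \<in> ?I \<and> rt b s \<in> orbit (rt (snd (k, b = c)) (\<rho> (fst (k, b = c))))"
        using k c unfolding mem by (cases b; cases c) auto
      fix i assume i: "i \<in> ?I \<and> rt b s \<in> orbit (rt (snd i) (\<rho> (fst i)))"
      then have r: "relp (b = snd i) s (\<rho> (fst i))" by (simp add: mem)
      then have "rel s (\<rho> (fst i))" unfolding rel_iff_relp by (cases "b = snd i") auto
      then have fst: "fst i = k" using k_unique i by auto
      then have "relp (b = snd i) s (\<rho> k)" using r by simp
      then have "(b = snd i) = c"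
        using relp_parity_unique[OF ev rho_pos_not_dvd[OF k(1)] _ c] by blast
      then show "i = (k, b = c)" using fst by (cases i) auto
    qed
  qed
  have prod_I: "(\<Prod>i\<in>?I. root_prod (orbit (rt (snd i) (\<rho> (fst i)))) ^ \<epsilon> i)
      = (\<Prod>k\<in>{1..e}. root_prod (S_set (\<rho> k)) ^ \<epsilon> (k, False) * root_prod (T_set (\<rho> k)) ^ \<epsilon> (k, True))" for \<epsilon>
  proof -
    have "(\<Prod>i\<in>?I. root_prod (orbit (rt (snd i) (\<rho> (fst i)))) ^ \<epsilon> i)
        = (\<Prod>k\<in>{1..e}. \<Prod>c\<in>UNIV. root_prod (orbit (rt c (\<rho> k))) ^ \<epsilon> (k, c))"
      by (subst prod.cartesian_product) (auto intro: prod.cong)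
    then show ?thesis unfolding S T by (simp add: UNIV_bool)
  qed
  have nz: "\<not> int l ^ m dvd \<rho> (fst i)" if "i \<in> ?I" for i
    using rho_pos_not_dvd that by auto
  note main = LCD_codes_by_coordinates[of ?I "\<lambda>i. \<rho> (fst i)" snd, OF _ nz unique]
  have main1: "LCD_negacyclic_codes q (2 * l ^ m * p ^ n) =
      {gen_code q (2 * l ^ m * p ^ n) ([:1, 0, 1:] ^ \<epsilon>0 *
        (\<Prod>k\<in>{1..e}. root_prod (S_set (\<rho> k)) ^ \<epsilon> (k, False) * root_prod (T_set (\<rho> k)) ^ \<epsilon> (k, True)))
        | \<epsilon>0 \<epsilon>. \<epsilon>0 \<in> {0, p ^ n} \<and> (\<forall>i\<in>?I. \<epsilon> i \<in> {0, p ^ n})}"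
    unfolding prod_I[symmetric] by (rule main(1)) simp_all
  show "LCD_negacyclic_codes q (2 * l ^ m * p ^ n) = ?rhs"
    unfolding main1
  proof (intro equalityI subsetI)
    fix C assume "C \<in> ?rhs"
    then obtain \<epsilon>0 \<epsilon> \<epsilon>' where *: "\<epsilon>0 \<in> {0, p ^ n}"
      "\<forall>k\<in>{1..e}. \<epsilon> k \<in> {0, p ^ n} \<and> \<epsilon>' k \<in> {0, p ^ n}"
      "C = gen_code q (2 * l ^ m * p ^ n) ([:1, 0, 1:] ^ \<epsilon>0 *
        (\<Prod>k\<in>{1..e}. root_prod (S_set (\<rho> k)) ^ \<epsilon> k * root_prod (T_set (\<rho> k)) ^ \<epsilon>' k))" by blast
    \<comment> \<open>Two exponent families on cosets are packed into one on pairs, with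
      \<open>False\<close> for \<open>S_set\<close> and \<open>True\<close> for
      \<open>T_set\<close>.\<close>
    define \<kappa> where "\<kappa> = (\<lambda>(k, c). if c then \<epsilon>' k else \<epsilon> k)"
    have "C = gen_code q (2 * l ^ m * p ^ n) ([:1, 0, 1:] ^ \<epsilon>0 *
        (\<Prod>k\<in>{1..e}. root_prod (S_set (\<rho> k)) ^ \<kappa> (k, False) * root_prod (T_set (\<rho> k)) ^ \<kappa> (k, True)))"
      by (simp add: *(3) \<kappa>_def)
    moreover have "\<forall>i\<in>?I. \<kappa> i \<in> {0, p ^ n}" using *(2) by (auto simp: \<kappa>_def)
    ultimately show "C \<in> {gen_code q (2 * l ^ m * p ^ n) ([:1, 0, 1:] ^ \<epsilon>0 *
        (\<Prod>k\<in>{1..e}. root_prod (S_set (\<rho> k)) ^ \<epsilon> (k, False) * root_prod (T_set (\<rho> k)) ^ \<epsilon> (k, True)))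
        | \<epsilon>0 \<epsilon>. \<epsilon>0 \<in> {0, p ^ n} \<and> (\<forall>i\<in>?I. \<epsilon> i \<in> {0, p ^ n})}"
      using *(1) by blast
  next
    fix C assume "C \<in> {gen_code q (2 * l ^ m * p ^ n) ([:1, 0, 1:] ^ \<epsilon>0 *
        (\<Prod>k\<in>{1..e}. root_prod (S_set (\<rho> k)) ^ \<epsilon> (k, False) * root_prod (T_set (\<rho> k)) ^ \<epsilon> (k, True)))
        | \<epsilon>0 \<epsilon>. \<epsilon>0 \<in> {0, p ^ n} \<and> (\<forall>i\<in>?I. \<epsilon> i \<in> {0, p ^ n})}"
    then obtain \<epsilon>0 \<kappa> where *: "\<epsilon>0 \<in> {0, p ^ n}" "\<forall>i\<in>?I. \<kappa> i \<in> {0, p ^ n}"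
      "C = gen_code q (2 * l ^ m * p ^ n) ([:1, 0, 1:] ^ \<epsilon>0 *
        (\<Prod>k\<in>{1..e}. root_prod (S_set (\<rho> k)) ^ \<kappa> (k, False) * root_prod (T_set (\<rho> k)) ^ \<kappa> (k, True)))"
      by blast
    then have "\<forall>k\<in>{1..e}. \<kappa> (k, False) \<in> {0, p ^ n} \<and> \<kappa> (k, True) \<in> {0, p ^ n}" by blast
    with *(1) show "C \<in> ?rhs" unfolding *(3)
      by (intro CollectI exI[of _ \<epsilon>0] exI[of _ "\<lambda>k. \<kappa> (k, False)"] exI[of _ "\<lambda>k. \<kappa> (k, True)"]) blast
  qed
  show "card (LCD_negacyclic_codes q (2 * l ^ m * p ^ n) :: 'b poly set set) = 2 ^ (1 + 2 * e)"
    by (subst main(2)) (simp_all add: card_cartesian_product mult.commute)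
qed

text \<open>Here -1 is an even power of \<open>q\<close>, so a Frobenius power negates exponents
  without touching signs. Together with inversion it exchanges the signs, which glues
  \<open>S_set\<close> and \<open>T_set\<close> into one orbit per coset.\<close>

lemma LCD_codes_0_mod_4:
  assumes f: "f mod 4 = 0"
  shows "LCD_negacyclic_codes q (2 * l ^ m * p ^ n) =
      {gen_code q (2 * l ^ m * p ^ n) ([:1, 0, 1:] ^ \<epsilon>0 *
        (\<Prod>k\<in>{1..e}. root_prod (S_set (\<rho> k)) ^ \<epsilon> k * root_prod (T_set (\<rho> k)) ^ \<epsilon> k))
        | \<epsilon>0 \<epsilon>. \<epsilon>0 \<in> {0, p ^ n} \<and> (\<forall>k\<in>{1..e}. \<epsilon> k \<in> {0, p ^ n})}"
    and "card (LCD_negacyclic_codes q (2 * l ^ m * p ^ n) :: 'b poly set set) = 2 ^ (1 + e)"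
proof -
  have ev: "even f" using f by presburger
  have "even (f div 2)" using f by presburger
  then have ev2: "even (f div 2 * l ^ (m - 1))" by simp
  have mem: "rt b s \<in> orbit (rt c u) \<longleftrightarrow> rel s u" for b c s u
    unfolding rt_in_orbit_iff relp_minus[OF q_power_minus_1[OF ev]] rel_iff_relp
    using ev2 by (cases "b = c") auto
  have prod: "root_prod (S_set (\<rho> k)) * root_prod (T_set (\<rho> k)) = root_prod (orbit (rt False (\<rho> k)))"
    if "k \<in> {1..e}" for k
  proof (rule root_prod_mult)
    show "S_set (\<rho> k) \<inter> T_set (\<rho> k) = {}"
    proof (rule root_set_eqI)
      fix b s
      show "rt b s \<in> S_set (\<rho> k) \<inter> T_set (\<rho> k) \<longleftrightarrow> rt b s \<in> {}"
        unfolding Int_iff rt_in_S_set_iff rt_in_T_set_iff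
        using relp_parity_unique[OF ev rho_pos_not_dvd[OF that]] by blast
    qed (rule le_infI1 empty_subsetI Un_least range_rt_subset_R)+
    show "S_set (\<rho> k) \<union> T_set (\<rho> k) = orbit (rt False (\<rho> k))"
    proof (rule root_set_eqI)
      fix b s
      show "rt b s \<in> S_set (\<rho> k) \<union> T_set (\<rho> k) \<longleftrightarrow> rt b s \<in> orbit (rt False (\<rho> k))"
        unfolding Un_iff[of _ "S_set (\<rho> k)"] rt_in_S_set_iff rt_in_T_set_iff mem rel_iff_relp
        by (cases b) auto
    qed (rule Un_least range_rt_subset_R orbit_subset_R rt_in_R)+
  qed
  have unique: "\<exists>!k. k \<in> {1..e} \<and> rt b s \<in> orbit (rt False (\<rho> k))"
    if "\<not> int l ^ m dvd s" for b s
    unfolding mem using ex1_rho_pos[OF that] .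
  note main = LCD_codes_by_coordinates[of "{1..e}" \<rho> "\<lambda>_. False", OF _ rho_pos_not_dvd unique]
  have "(\<Prod>k\<in>{1..e}. root_prod (S_set (\<rho> k)) ^ \<epsilon> k * root_prod (T_set (\<rho> k)) ^ \<epsilon> k)
      = (\<Prod>k\<in>{1..e}. root_prod (orbit (rt False (\<rho> k))) ^ \<epsilon> k)" for \<epsilon>
    by (intro prod.cong refl) (simp only: prod power_mult_distrib[symmetric])
  then show "LCD_negacyclic_codes q (2 * l ^ m * p ^ n) =
      {gen_code q (2 * l ^ m * p ^ n) ([:1, 0, 1:] ^ \<epsilon>0 *
        (\<Prod>k\<in>{1..e}. root_prod (S_set (\<rho> k)) ^ \<epsilon> k * root_prod (T_set (\<rho> k)) ^ \<epsilon> k))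
        | \<epsilon>0 \<epsilon>. \<epsilon>0 \<in> {0, p ^ n} \<and> (\<forall>k\<in>{1..e}. \<epsilon> k \<in> {0, p ^ n})}"
    by (simp only:) (rule main(1); simp)
  show "card (LCD_negacyclic_codes q (2 * l ^ m * p ^ n) :: 'b poly set set) = 2 ^ (1 + e)"
    using main(2) by simp
qed

end

section \<open>The case of odd order of q modulo l\<close>

lemma relp_odd_period:
  assumes "odd f"
  shows "relp b s u \<longleftrightarrow> rel s u"
proof
  assume "rel s u"
  then obtain i where i: "[s = u * int q ^ i] (mod int l ^ m)" by (auto simp: rel_def)
  \<comment> \<open>Adding this odd period changes the parity of the exponent but not the congruence
    class.\<close>
  let ?d = "f * l ^ (m - 1)"
  have "[u * int q ^ i * int q ^ ?d = u * int q ^ i * 1] (mod int l ^ m)"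
    using q_power_period by (rule cong_scalar_left)
  then have i': "[s = u * int q ^ (i + ?d)] (mod int l ^ m)"
    using i by (simp add: power_add mult.assoc) (meson cong_sym cong_trans)
  have "odd ?d" using assms odd_l by simp
  then have "even i \<noteq> even (i + ?d)" by simp
  then show "relp b s u" unfolding relp_def using i i' by (metis (full_types))
next
  assume "relp b s u"
  then show "rel s u" unfolding rel_iff_relp by (cases b) auto
qed

lemma rel_minus_disjoint:
  assumes "odd f" "\<not> int l ^ m dvd u" "rel s u"
  shows "\<not> rel s (- u)"
proof
  assume "rel s (- u)"
  then obtain i j where "[s = u * int q ^ i] (mod int l ^ m)" "[s = - u * int q ^ j] (mod int l ^ m)"
    using assms(3) by (auto simp: rel_def)
  then have "[u * int q ^ i = - u * int q ^ j] (mod int l ^ m)" by (meson cong_sym cong_trans)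
  then show False using not_cong_minus[OF assms(1,2)] by blast
qed

text \<open>Parity carries no information here, so an orbit consists of both signs over the cosets
  of \<open>u\<close> and \<open>-u\<close>. These cosets are distinct, which makes \<open>I\<close>
  and \<open>J\<close> coprime and calls for a transversal of cosets up to negation.\<close>

lemma LCD_codes_odd:
  assumes tq: "t ^ q = - t" and f: "odd f" and g: "residue_primroot (l ^ m) g"
  defines "\<delta> \<equiv> \<lambda>r. totient (l ^ r) div ord (l ^ r) q"
  defines "u \<equiv> \<lambda>r k. int (l ^ (m - r) * g ^ k)"
  defines "I \<equiv> \<lambda>r k. hat (scaleX (Mpoly \<eta> q (l ^ m) (u r k)) t)
      * hat (scaleX (Mpoly \<eta> q (l ^ m) (u r k)) (- t))"
  defines "J \<equiv> \<lambda>r k. hat (scaleX (Mpoly \<eta> q (l ^ m) (- u r k)) t)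
      * hat (scaleX (Mpoly \<eta> q (l ^ m) (- u r k)) (- t))"
  shows "LCD_negacyclic_codes q (2 * l ^ m * p ^ n) =
      {gen_code q (2 * l ^ m * p ^ n) ([:1, 0, 1:] ^ \<epsilon>0 *
        (\<Prod>r\<in>{1..m}. \<Prod>k\<in>{0..<\<delta> r div 2}. I r k ^ \<epsilon> r k * J r k ^ \<epsilon> r k))
        | \<epsilon>0 \<epsilon>. \<epsilon>0 \<in> {0, p ^ n} \<and> (\<forall>r\<in>{1..m}. \<forall>k\<in>{0..<\<delta> r div 2}. \<epsilon> r k \<in> {0, p ^ n})}"
      (is "_ = ?rhs")
    and "card (LCD_negacyclic_codes q (2 * l ^ m * p ^ n) :: 'b poly set set) = 2 ^ (1 + e div 2)"
proof -
  interpret odd_order_primroot l m q g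
    by unfold_locales (use f g in auto)
  let ?K = "Sigma {1..m} (\<lambda>r. {0..<\<delta> r div 2})"
  define v where "v i = u (fst i) (snd i)" for i
  have nz: "\<not> int l ^ m dvd v i" if "i \<in> ?K" for i
  proof
    assume "int l ^ m dvd v i"
    have "m = m - fst i + fst i" using that by auto
    then have "int l ^ m = int l ^ (m - fst i) * int l ^ fst i" by (metis power_add)
    then have "int l ^ (m - fst i) * int l ^ fst i dvd int l ^ (m - fst i) * int g ^ snd i"
      using \<open>int l ^ m dvd v i\<close> by (simp add: v_def u_def)
    then have "int l ^ fst i dvd int g ^ snd i"
      using prime_l by (simp add: prime_gt_0_nat)
    moreover have "int l dvd int l ^ fst i" using that by auto
    ultimately show False using not_dvd_g_power dvd_trans by blast
  qed
  have mem: "rt b s \<in> orbit (rt c w) \<longleftrightarrow> rel s w \<or> rel s (- w)" for b c s w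
    unfolding rt_in_orbit_iff[OF tq] relp_odd_period[OF f] ..
  have ex1: "\<exists>!i. i \<in> ?K \<and> (rel s (v i) \<or> rel s (- v i))" if nd: "\<not> int l ^ m dvd s" for s
  proof -
    obtain r k where rk: "(r, k) \<in> ?K" "rel s (v (r, k)) \<or> rel s (- v (r, k))"
      using transversal_exists[OF nd] unfolding rel_def v_def u_def \<delta>_def by fastforce
    show ?thesis
    proof (rule ex1I[of _ "(r, k)"])
      fix i assume i: "i \<in> ?K \<and> (rel s (v i) \<or> rel s (- v i))"
      obtain r' k' where i': "i = (r', k')" by (cases i)
      \<comment> \<open>The signs are carried as factors 1 or -1, so that all four combinations
        reduce to one congruence whose sign is the product \<open>c * c'\<close>.\<close>
      from rk(2) obtain c where c: "c = 1 \<or> c = -1" "rel s (c * v (r, k))"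
        by (metis mult_1 mult_minus1)
      from i i' obtain c' where c': "c' = 1 \<or> c' = -1" "rel s (c' * v (r', k'))"
        by (metis mult_1 mult_minus1)
      have "rel (c * v (r, k)) (c' * v (r', k'))"
        using c(2) c'(2) rel_sym rel_trans by blast
      then have "rel (v (r, k)) (c * (c' * v (r', k')))"
        using c(1) rel_minus[of "v (r, k)" "- (c' * v (r', k'))"] by auto
      then have "rel (v (r, k)) ((c * c') * v (r', k'))" by (simp only: mult.assoc)
      then obtain j where "[v (r, k) * int q ^ 0 = (c * c') * v (r', k') * int q ^ j] (mod int l ^ m)"
        by (auto simp: rel_def)
      moreover have "c * c' = 1 \<or> c * c' = -1" using c(1) c'(1) by auto
      ultimately have "r = r' \<and> k = k'"
        using transversal_unique[of r r' k k' 0 "c * c'" j] rk(1) i i'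
        unfolding v_def u_def \<delta>_def by simp
      then show "i = (r, k)" using i' by simp
    qed (use rk in simp)
  qed
  have prod: "I r k * J r k = root_prod (orbit (rt False (v (r, k))))" if rk: "(r, k) \<in> ?K" for r k
  proof -
    let ?A = "\<lambda>w. range (\<lambda>i. rt False (w * int q ^ i)) \<union> range (\<lambda>i. rt True (w * int q ^ i))"
    have A: "rt b s \<in> ?A w \<longleftrightarrow> rel s w" for b s w
      unfolding Un_iff rt_in_range_iff by (cases b) auto
    have poly: "hat (scaleX (Mpoly \<eta> q (l ^ m) w) t) * hat (scaleX (Mpoly \<eta> q (l ^ m) w) (- t))
        = root_prod (?A w)" for w
      unfolding hat_Mpoly by (rule root_prod_mult) (auto simp: rt_eq_iff)
    have "root_prod (?A (u r k)) * root_prod (?A (- u r k)) = root_prod (orbit (rt False (u r k)))"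
    proof (rule root_prod_mult)
      show "?A (u r k) \<inter> ?A (- u r k) = {}"
      proof (rule root_set_eqI)
        show "rt b s \<in> ?A (u r k) \<inter> ?A (- u r k) \<longleftrightarrow> rt b s \<in> {}" for b s
          unfolding Int_iff A using rel_minus_disjoint[OF f nz[OF rk]] by (auto simp: v_def)
      qed (rule le_infI1 empty_subsetI Un_least range_rt_subset_R)+
      show "?A (u r k) \<union> ?A (- u r k) = orbit (rt False (u r k))"
      proof (rule root_set_eqI)
        show "rt b s \<in> ?A (u r k) \<union> ?A (- u r k) \<longleftrightarrow> rt b s \<in> orbit (rt False (u r k))" for b s
          unfolding Un_iff[of _ "?A (u r k)"] A mem ..
      qed (rule Un_least range_rt_subset_R orbit_subset_R rt_in_R)+
    qed
    then show ?thesis unfolding I_def J_def poly v_def by simp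
  qed
  have prod_K: "(\<Prod>r\<in>{1..m}. \<Prod>k\<in>{0..<\<delta> r div 2}. I r k ^ \<epsilon> r k * J r k ^ \<epsilon> r k)
      = (\<Prod>i\<in>?K. root_prod (orbit (rt False (v i))) ^ \<epsilon> (fst i) (snd i))" for \<epsilon>
  proof -
    have "(\<Prod>r\<in>{1..m}. \<Prod>k\<in>{0..<\<delta> r div 2}. I r k ^ \<epsilon> r k * J r k ^ \<epsilon> r k)
        = (\<Prod>(r, k)\<in>?K. I r k ^ \<epsilon> r k * J r k ^ \<epsilon> r k)"
      by (rule prod.Sigma) auto
    also have "\<dots> = (\<Prod>i\<in>?K. root_prod (orbit (rt False (v i))) ^ \<epsilon> (fst i) (snd i))"
    proof (rule prod.cong[OF refl])
      fix i assume i: "i \<in> ?K"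
      obtain r k where "i = (r, k)" by (cases i)
      then show "(case i of (r, k) \<Rightarrow> I r k ^ \<epsilon> r k * J r k ^ \<epsilon> r k)
          = root_prod (orbit (rt False (v i))) ^ \<epsilon> (fst i) (snd i)"
        using prod[of r k] i by (simp add: power_mult_distrib[symmetric])
    qed
    finally show ?thesis .
  qed
  note main = LCD_codes_by_coordinates[OF tq, of ?K v "\<lambda>_. False", unfolded mem]
  have main1: "LCD_negacyclic_codes q (2 * l ^ m * p ^ n) =
      {gen_code q (2 * l ^ m * p ^ n)
        ([:1, 0, 1:] ^ \<epsilon>0 * (\<Prod>i\<in>?K. root_prod (orbit (rt False (v i))) ^ \<epsilon> i))
        | \<epsilon>0 \<epsilon>. \<epsilon>0 \<in> {0, p ^ n} \<and> (\<forall>i\<in>?K. \<epsilon> i \<in> {0, p ^ n})}"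
    by (rule main(1)) (use nz ex1 in auto)
  show "LCD_negacyclic_codes q (2 * l ^ m * p ^ n) = ?rhs"
    unfolding main1 prod_K
  proof (intro equalityI subsetI)
    fix C assume "C \<in> {gen_code q (2 * l ^ m * p ^ n)
        ([:1, 0, 1:] ^ \<epsilon>0 * (\<Prod>i\<in>?K. root_prod (orbit (rt False (v i))) ^ \<epsilon> i))
        | \<epsilon>0 \<epsilon>. \<epsilon>0 \<in> {0, p ^ n} \<and> (\<forall>i\<in>?K. \<epsilon> i \<in> {0, p ^ n})}"
    then obtain \<epsilon>0 \<epsilon> where *: "C = gen_code q (2 * l ^ m * p ^ n)
        ([:1, 0, 1:] ^ \<epsilon>0 * (\<Prod>i\<in>?K. root_prod (orbit (rt False (v i))) ^ \<epsilon> i))"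
        "\<epsilon>0 \<in> {0, p ^ n}" "\<forall>i\<in>?K. \<epsilon> i \<in> {0, p ^ n}" by blast
    have "\<forall>r\<in>{1..m}. \<forall>k\<in>{0..<\<delta> r div 2}. curry \<epsilon> r k \<in> {0, p ^ n}" using *(3) by auto
    then show "C \<in> {gen_code q (2 * l ^ m * p ^ n) ([:1, 0, 1:] ^ \<epsilon>0 *
        (\<Prod>i\<in>?K. root_prod (orbit (rt False (v i))) ^ \<epsilon> (fst i) (snd i)))
        | \<epsilon>0 \<epsilon>. \<epsilon>0 \<in> {0, p ^ n} \<and> (\<forall>r\<in>{1..m}. \<forall>k\<in>{0..<\<delta> r div 2}. \<epsilon> r k \<in> {0, p ^ n})}"
      using *(1,2) by (intro CollectI exI[of _ \<epsilon>0] exI[of _ "curry \<epsilon>"]) simp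
  next
    fix C assume "C \<in> {gen_code q (2 * l ^ m * p ^ n) ([:1, 0, 1:] ^ \<epsilon>0 *
        (\<Prod>i\<in>?K. root_prod (orbit (rt False (v i))) ^ \<epsilon> (fst i) (snd i)))
        | \<epsilon>0 \<epsilon>. \<epsilon>0 \<in> {0, p ^ n} \<and> (\<forall>r\<in>{1..m}. \<forall>k\<in>{0..<\<delta> r div 2}. \<epsilon> r k \<in> {0, p ^ n})}"
    then obtain \<epsilon>0 \<epsilon> where *: "C = gen_code q (2 * l ^ m * p ^ n) ([:1, 0, 1:] ^ \<epsilon>0 *
        (\<Prod>i\<in>?K. root_prod (orbit (rt False (v i))) ^ \<epsilon> (fst i) (snd i)))"
        "\<epsilon>0 \<in> {0, p ^ n}" "\<forall>r\<in>{1..m}. \<forall>k\<in>{0..<\<delta> r div 2}. \<epsilon> r k \<in> {0, p ^ n}" by blast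
    then show "C \<in> {gen_code q (2 * l ^ m * p ^ n)
        ([:1, 0, 1:] ^ \<epsilon>0 * (\<Prod>i\<in>?K. root_prod (orbit (rt False (v i))) ^ \<epsilon> i))
        | \<epsilon>0 \<epsilon>. \<epsilon>0 \<in> {0, p ^ n} \<and> (\<forall>i\<in>?K. \<epsilon> i \<in> {0, p ^ n})}"
      by (intro CollectI exI[of _ \<epsilon>0] exI[of _ "\<lambda>i. \<epsilon> (fst i) (snd i)"]) auto
  qed
  \<comment> \<open>Every nonzero coset contains exactly one signed element of the transversal, so
    \<open>e\<close> is twice the number of orbits away from \<open>X^2 + 1\<close>.\<close>
  define P where "P k x = rel (\<rho> k) ((if snd x then 1 else -1) * v (fst x))" for k x
  have "card {1..e} = card (?K \<times> (UNIV :: bool set))"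
  proof (rule card_eq_if_unique_relation[where P = P])
    fix k assume "k \<in> {1..e}"
    then have nd: "\<not> int l ^ m dvd \<rho> k" by (rule rho_pos_not_dvd)
    obtain i where i: "i \<in> ?K" "rel (\<rho> k) (v i) \<or> rel (\<rho> k) (- v i)"
      using ex1[OF nd] by blast
    have disj: "\<not> (rel (\<rho> k) (v i) \<and> rel (\<rho> k) (- v i))"
      using rel_minus_disjoint[OF f nz[OF i(1)]] by blast
    show "\<exists>!x. x \<in> ?K \<times> UNIV \<and> P k x"
    proof (rule ex1I[of _ "(i, rel (\<rho> k) (v i))"])
      show "(i, rel (\<rho> k) (v i)) \<in> ?K \<times> UNIV \<and> P k (i, rel (\<rho> k) (v i))"
        using i by (auto simp: P_def)
      fix x assume x: "x \<in> ?K \<times> (UNIV :: bool set) \<and> P k x"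
      then have "fst x \<in> ?K" "rel (\<rho> k) (v (fst x)) \<or> rel (\<rho> k) (- v (fst x))"
        by (auto simp: P_def split: if_splits)
      then have "fst x = i" using ex1[OF nd] i by metis
      moreover have "snd x = rel (\<rho> k) (v i)"
        using x disj \<open>fst x = i\<close> by (auto simp: P_def split: if_splits)
      ultimately show "x = (i, rel (\<rho> k) (v i))" by (cases x) auto
    qed
  next
    fix x assume "x \<in> ?K \<times> (UNIV :: bool set)"
    then have "\<not> int l ^ m dvd (if snd x then 1 else -1) * v (fst x)" using nz by auto
    from ex1_rho_pos[OF this] show "\<exists>!k. k \<in> {1..e} \<and> P k x"
      unfolding P_def using rel_sym by blast
  qed
  then have "e = 2 * card ?K" by (simp add: card_cartesian_product)
  moreover have "card (LCD_negacyclic_codes q (2 * l ^ m * p ^ n) :: 'b poly set set) = 2 ^ (1 + card ?K)"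
    by (rule main(2)) (use nz ex1 in auto)
  ultimately show "card (LCD_negacyclic_codes q (2 * l ^ m * p ^ n) :: 'b poly set set) = 2 ^ (1 + e div 2)"
    by simp
qed

end

section \<open>Assembly of the four congruence cases\<close>

theorem theorem4p5:
  fixes p q l m n e g :: nat
    and \<eta> :: "'b::{field, finite}"
    and \<rho> :: "nat \<Rightarrow> int"
  assumes "prime p" "odd p"
    and "\<exists>a\<ge>1. q = p ^ a"
    and "prime l" "odd l" "l \<noteq> p"
    and "m > 0" "n > 0"
    and "CHAR('b) = p" "card (Fq q :: 'b set) = q"
    and "prim_root_unity \<eta> (l ^ m)"
    and "coset_reps q (l ^ m) \<rho> e"
    and "residue_primroot (l ^ m) g"
  shows
   "(let f = ord l q; N = 2 * l ^ m * p ^ n; M = l ^ m;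
         Mp = Mpoly \<eta> q M; Np = Npoly \<eta> q M;
         \<delta> = (\<lambda>r. totient (l ^ r) div ord (l ^ r) q);
         X21 = [:1, 0, 1:] :: 'b poly
     in
     (q mod 4 = 1 \<longrightarrow>
        (\<forall>\<gamma> \<beta> :: 'b. \<gamma> \<in> Fq q \<and> \<gamma> ^ 4 = 1 \<and> \<gamma> ^ 2 \<noteq> 1 \<and>
            \<beta> \<in> Fq q \<and> \<beta> ^ M * \<gamma> = 1 \<and> inverse \<beta> = - \<beta> \<longrightarrow>
          LCD_negacyclic_codes q N =
            {gen_code q N (\<Prod>i\<in>{0..e}. hat (scaleX (Mp (\<rho> i)) \<beta>) ^ \<epsilon> i
                                       * hat (scaleX (Mp (- \<rho> i)) (- \<beta>)) ^ \<epsilon> i)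
              | \<epsilon>. \<forall>i\<le>e. \<epsilon> i \<in> {0, p ^ n}}
          \<and> card (LCD_negacyclic_codes q N :: 'b poly set set) = 2 ^ (e + 1)))
   \<and>
     (q mod 4 = 3 \<longrightarrow>
        (\<forall>\<zeta> \<theta> :: 'b. \<zeta> ^ (q ^ 2) = \<zeta> \<and> \<zeta> ^ 2 = - 1 \<and>
            \<theta> ^ (q ^ 2) = \<theta> \<and> \<theta> ^ M * \<zeta> = 1 \<and> inverse \<theta> = \<theta> ^ q \<and> \<theta> ^ q = - \<theta> \<longrightarrow>
          (let I = (\<lambda>r k. hat (scaleX (Mp (int (l ^ (m - r) * g ^ k))) \<theta>)
                         * hat (scaleX (Mp (int (l ^ (m - r) * g ^ k))) (- \<theta>)));
               J = (\<lambda>r k. hat (scaleX (Mp (- int (l ^ (m - r) * g ^ k))) \<theta>)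
                         * hat (scaleX (Mp (- int (l ^ (m - r) * g ^ k))) (- \<theta>)));
               S = (\<lambda>k. hat (scaleX (Np (\<rho> k)) \<theta>) * hat (scaleX (Np (\<rho> k * int q)) (- \<theta>)));
               T = (\<lambda>k. hat (scaleX (Np (\<rho> k)) (- \<theta>)) * hat (scaleX (Np (\<rho> k * int q)) \<theta>))
           in
           (odd f \<longrightarrow>
              LCD_negacyclic_codes q N =
                {gen_code q N (X21 ^ \<epsilon>0 *
                   (\<Prod>r\<in>{1..m}. \<Prod>k\<in>{0..<\<delta> r div 2}. I r k ^ \<epsilon> r k * J r k ^ \<epsilon> r k))
                  | \<epsilon>0 \<epsilon>. \<epsilon>0 \<in> {0, p ^ n} \<and>
                      (\<forall>r\<in>{1..m}. \<forall>k\<in>{0..<\<delta> r div 2}. \<epsilon> r k \<in> {0, p ^ n})}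
              \<and> card (LCD_negacyclic_codes q N :: 'b poly set set) = 2 ^ (1 + e div 2))
           \<and>
           (f mod 4 = 2 \<longrightarrow>
              LCD_negacyclic_codes q N =
                {gen_code q N (X21 ^ \<epsilon>0 * (\<Prod>k\<in>{1..e}. S k ^ \<epsilon> k * T k ^ \<epsilon>' k))
                  | \<epsilon>0 \<epsilon> \<epsilon>'. \<epsilon>0 \<in> {0, p ^ n} \<and>
                      (\<forall>k\<in>{1..e}. \<epsilon> k \<in> {0, p ^ n} \<and> \<epsilon>' k \<in> {0, p ^ n})}
              \<and> card (LCD_negacyclic_codes q N :: 'b poly set set) = 2 ^ (1 + 2 * e))
           \<and>
           (f mod 4 = 0 \<longrightarrow>
              LCD_negacyclic_codes q N =
                {gen_code q N (X21 ^ \<epsilon>0 * (\<Prod>k\<in>{1..e}. S k ^ \<epsilon> k * T k ^ \<epsilon> k))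
                  | \<epsilon>0 \<epsilon>. \<epsilon>0 \<in> {0, p ^ n} \<and> (\<forall>k\<in>{1..e}. \<epsilon> k \<in> {0, p ^ n})}
              \<and> card (LCD_negacyclic_codes q N :: 'b poly set set) = 2 ^ (1 + e))))))"
proof -
  obtain a where q: "q = p ^ a" using assms(3) by blast
  have "coprime l q"
    using assms(1,4,6) q by (simp add: primes_coprime)
  then have roots_locale: "negacyclic_2lm l m q p e \<eta> t \<rho>" if "t \<noteq> 0" "inverse t = - t" for t :: 'b
  proof -
    have "t * t = -1" using that by (metis right_inverse mult_minus_right minus_minus)
    then show ?thesis
      using assms q \<open>coprime l q\<close> by unfold_locales (auto simp: power2_eq_square)
  qed
  have "l ^ m > 0" using assms(4) by (simp add: prime_gt_0_nat)
  \<comment> \<open>In Isabelle \<open>inverse 0 = - 0\<close> holds, so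
    \<open>inverse t = - t\<close> does not exclude \<open>t = 0\<close>; the equation with
    \<open>t ^ (l ^ m)\<close> does, because the exponent is positive.\<close>
  then have nz: "t \<noteq> 0" if "t ^ (l ^ m) * z = 1" for t z :: 'b
    using that by (auto simp: power_0_left)
  show ?thesis
    unfolding Let_def
  \<comment> \<open>The eight goals come in pairs, the list of codes and their number, one pair for
    each of the four cases.\<close>
  proof (intro conjI impI allI, goal_cases)
    case (1 \<gamma> \<beta>)
    then interpret negacyclic_2lm l m q p n e \<eta> \<beta> \<rho> by (intro roots_locale nz) auto
    show ?case using 1 by (intro LCD_codes_fixed(1)) (simp add: Fq_def)
  next
    case (2 \<gamma> \<beta>)
    then interpret negacyclic_2lm l m q p n e \<eta> \<beta> \<rho> by (intro roots_locale nz) auto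
    show ?case using 2 by (intro LCD_codes_fixed(2)) (simp add: Fq_def)
  next
    case (3 \<zeta> \<theta>)
    then interpret negacyclic_2lm l m q p n e \<eta> \<theta> \<rho> by (intro roots_locale nz) auto
    show ?case using 3 assms(13) by (intro LCD_codes_odd(1)) auto
  next
    case (4 \<zeta> \<theta>)
    then interpret negacyclic_2lm l m q p n e \<eta> \<theta> \<rho> by (intro roots_locale nz) auto
    show ?case using 4 assms(13) by (intro LCD_codes_odd(2)) auto
  next
    case (5 \<zeta> \<theta>)
    then interpret negacyclic_2lm l m q p n e \<eta> \<theta> \<rho> by (intro roots_locale nz) auto
    show ?case unfolding S_poly T_poly using 5 by (intro LCD_codes_2_mod_4(1)) auto
  next
    case (6 \<zeta> \<theta>)
    then interpret negacyclic_2lm l m q p n e \<eta> \<theta> \<rho> by (intro roots_locale nz) auto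
    show ?case using 6 by (intro LCD_codes_2_mod_4(2)) auto
  next
    case (7 \<zeta> \<theta>)
    then interpret negacyclic_2lm l m q p n e \<eta> \<theta> \<rho> by (intro roots_locale nz) auto
    show ?case unfolding S_poly T_poly using 7 by (intro LCD_codes_0_mod_4(1)) auto
  next
    case (8 \<zeta> \<theta>)
    then interpret negacyclic_2lm l m q p n e \<eta> \<theta> \<rho> by (intro roots_locale nz) auto
    show ?case using 8 by (intro LCD_codes_0_mod_4(2)) auto
  qed
qed

end
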